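(* Let $\Omega$ be an open subset of the open unit ball, let $\beta:\Omega\to\mathbb B_N$ be continuous, and let $K_\beta(z,w)=\frac{1}{1-\langle\beta(z),\beta(w)\rangle}$, $z,w\in\Omega$. Let $S$ be a $\mathbb C^{p\times q}$-valued Schur multiplier of $\mathcal H(K_\beta)$, with representation $S(z)=G(\beta(z))$, where $G$ is a $\mathbb C^{p\times q}$-valued Schur multiplier of the Drury-Arveson space on $\mathbb B_N$. Let $w_0\in\Omega$ and $\xi\in\mathbb C^p$ be such that $\xi^*S(w_0)S(w_0)^*\xi<\xi^*\xi$. Put $\eta=S(w_0)^*\xi\in\mathbb C^q$, $c=\begin{pmatrix}\xi\\ \eta\end{pmatrix}$, $J_{p,q}=\begin{pmatrix}I_p&0\\0&-I_q\end{pmatrix}$, so $c^*J_{p,q}c=\xi^*\xi-\eta^*\eta$, and let $U=\begin{pmatrix}U_1&U_2\\ U_3&U_4\end{pmatrix}$ be a $p\times p$ unitary matrix, with $U_1$ of size $(p-1)\times(p-1)$, whose last column is $\begin{pmatrix}U_2\\ U_4\end{pmatrix}=\frac{\xi}{\sqrt{\xi^*\xi}}$. Then there exists a $\mathbb C^{(p-1+N)\times q}$-valued Schur multiplier $s_{\beta(w_0)}$ of the Drury-Arveson space on $\mathbb B_N$ such that, for all $z\in\Omega$, $$S(z)=\left(\begin{pmatrix}\frac{\xi b_{\beta(w_0)}(\beta(z))}{\sqrt{c^*J_{p,q}c}}&\begin{pmatrix}U_1\\ U_3\end{pmatrix}\end{pmatrix}s_{\beta(w_0)}(\beta(z))+\frac{\xi\eta^*}{c^*J_{p,q}c}\left(I_q+\frac{\eta\eta^*}{c^*J_{p,q}c}\right)^{-1/2}\right)\left(\begin{pmatrix}\frac{\eta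 b_{\beta(w_0)}(\beta(z))}{\sqrt{c^*J_{p,q}c}}&0\end{pmatrix}s_{\beta(w_0)}(\beta(z))+\left(I_q+\frac{\eta\eta^*}{c^*J_{p,q}c}\right)^{1/2}\right)^{-1},$$ where the $0$ block has size $q\times(p-1)$.
   Context: $N,p,q$ are positive integers. $\mathbb B_N$ is the open unit ball of $\mathbb C^N$ (row vectors), with $\langle\lambda,\mu\rangle=\lambda\mu^*$. For a positive (semidefinite) kernel $k$ on a set $X$ with reproducing kernel Hilbert space $\mathcal H(k)$, a $\mathbb C^{r\times t}$-valued Schur multiplier of $\mathcal H(k)$ is a function $\sigma:X\to\mathbb C^{r\times t}$ such that $(I_r-\sigma(z)\sigma(w)^* )k(z,w)$ is a positive kernel on $X$. The Drury-Arveson space on $\mathbb B_N$ is the reproducing kernel Hilbert space with kernel $\frac{1}{1-\langle\lambda,\mu\rangle}$. For $\nu\in\mathbb B_N$ the Blaschke factor is the $\mathbb C^{1\times N}$-valued function $b_\nu(\lambda)=\frac{(1-\langle\nu,\nu\rangle)^{1/2}}{1-\langle\lambda,\nu\rangle}(\lambda-\nu)(I_N-\nu^*\nu)^{-1/2}$. When $p=1$ the blocks $U_1,U_3$ and the $0$ block are absent. *)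

theory Defs
  imports "HOL-Analysis.Analysis" "Jordan_Normal_Form.Schur_Decomposition"
begin

text \<open>
  All matrices are matrices \<^typ>\<open>complex mat\<close> with explicit dimensions, so that blocks of width
  or height 0 are allowed.  Elements of the \<open>N\<close>-dimensional ball are \<open>1 \<times> N\<close> row matrices, the
  vectors \<open>\<xi>\<close>, \<open>\<eta>\<close> are column matrices, and the conjugate transpose is \<^const>\<open>mat_adjoint\<close>.
  Inequalities between complex numbers are those of \<^theory>\<open>HOL-Library.Complex_Order\<close>;
  in particular \<open>0 \<le> x\<close> says that \<open>x\<close> is real and nonnegative.
\<close>

definition entry :: "complex mat \<Rightarrow> complex"  \<comment> \<open>a \<open>1 \<times> 1\<close> matrix as a scalar\<close>
  where "entry A = A $$ (0, 0)"

definition row_inner :: "complex mat \<Rightarrow> complex mat \<Rightarrow> complex"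
  where "row_inner x y = entry (x * mat_adjoint y)"

definition unit_ball :: "nat \<Rightarrow> complex mat set"
  where "unit_ball N = {x \<in> carrier_mat 1 N. Re (row_inner x x) < 1}"

definition append_cols :: "complex mat \<Rightarrow> complex mat \<Rightarrow> complex mat" (infixr \<open>@\<^sub>c\<close> 65)
  where "A @\<^sub>c B = four_block_mat A B (0\<^sub>m 0 (dim_col A)) (0\<^sub>m 0 (dim_col B))"

definition unitary_mat :: "nat \<Rightarrow> complex mat \<Rightarrow> bool"
  where "unitary_mat n U \<longleftrightarrow>
    U \<in> carrier_mat n n \<and> U * mat_adjoint U = 1\<^sub>m n \<and> mat_adjoint U * U = 1\<^sub>m n"

definition psd_mat :: "nat \<Rightarrow> complex mat \<Rightarrow> bool"
  where "psd_mat n A \<longleftrightarrow> A \<in> carrier_mat n n \<and> mat_adjoint A = A \<and>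
    (\<forall>v \<in> carrier_mat n 1. 0 \<le> entry (mat_adjoint v * A * v))"

text \<open>The positive semidefinite square root; meaningful only for positive semidefinite \<open>A\<close>.\<close>

definition mat_sqrt :: "complex mat \<Rightarrow> complex mat"
  where "mat_sqrt A = (THE B. psd_mat (dim_row A) B \<and> B * B = A)"

text \<open>The inverse; meaningful only for invertible \<open>A\<close>.\<close>

definition mat_inv :: "complex mat \<Rightarrow> complex mat"
  where "mat_inv A = the (mat_inverse A)"

definition positive_kernel :: "nat \<Rightarrow> 'x set \<Rightarrow> ('x \<Rightarrow> 'x \<Rightarrow> complex mat) \<Rightarrow> bool"
  where "positive_kernel r X K \<longleftrightarrow>
    (\<forall>z \<in> X. \<forall>w \<in> X. K z w \<in> carrier_mat r r) \<and>
    (\<forall>(m::nat) (x :: nat \<Rightarrow> 'x) (a :: nat \<Rightarrow> complex mat).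
       (\<forall>i<m. x i \<in> X \<and> a i \<in> carrier_mat r 1) \<longrightarrow>
       0 \<le> (\<Sum>i<m. \<Sum>j<m. entry (mat_adjoint (a i) * K (x i) (x j) * a j)))"

text \<open>
  \<open>\<sigma>\<close> is an \<open>r \<times> t\<close> matrix valued Schur multiplier of the reproducing kernel Hilbert space of
  the scalar positive kernel \<open>k\<close> on \<open>X\<close>.
\<close>

definition schur_multiplier ::
    "nat \<Rightarrow> nat \<Rightarrow> 'x set \<Rightarrow> ('x \<Rightarrow> 'x \<Rightarrow> complex) \<Rightarrow> ('x \<Rightarrow> complex mat) \<Rightarrow> bool"
  where "schur_multiplier r t X k \<sigma> \<longleftrightarrow>
    (\<forall>z \<in> X. \<sigma> z \<in> carrier_mat r t) \<and>
    positive_kernel r X (\<lambda>z w. k z w \<cdot>\<^sub>m (1\<^sub>m r - \<sigma> z * mat_adjoint (\<sigma> w)))"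

definition drury_arveson :: "complex mat \<Rightarrow> complex mat \<Rightarrow> complex"
  where "drury_arveson x y = 1 / (1 - row_inner x y)"

definition blaschke :: "nat \<Rightarrow> complex mat \<Rightarrow> complex mat \<Rightarrow> complex mat"
  where "blaschke N \<nu> x =
    (complex_of_real (sqrt (1 - Re (row_inner \<nu> \<nu>))) / (1 - row_inner x \<nu>)) \<cdot>\<^sub>m
      ((x - \<nu>) * mat_inv (mat_sqrt (1\<^sub>m N - mat_adjoint \<nu> * \<nu>)))"

definition J_mat :: "nat \<Rightarrow> nat \<Rightarrow> complex mat"
  where "J_mat p q = four_block_mat (1\<^sub>m p) (0\<^sub>m p q) (0\<^sub>m q p) (- 1\<^sub>m q)"

end

theory Submission
  imports Defs
begin

text \<open>
  Put \<open>\<nu> = \<beta> w0\<close> and work on the whole ball, with \<open>G\<close> in place of \<open>S\<close>.  Let \<open>A\<close>, \<open>B\<close>, \<open>C\<close>, \<open>D\<close> be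
  the coefficients of the linear fractional transformation, where \<open>A\<close> and \<open>C\<close> are functions on the
  ball.  Then \<open>G (C s + D) = A s + B\<close> is the linear equation \<open>P s = - Q\<close> for \<open>s\<close>, where \<open>P = A - G C\<close>
  and \<open>Q = B - G D\<close>.

  Let \<open>b\<close> be the Blaschke factor at \<open>\<nu>\<close>.  The column \<open>c / sqrt \<delta>\<close>, the columns of \<open>U\<close> other than the
  last with zeros below, and the columns of \<open>B\<close> over \<open>D\<close> form a basis that is orthonormal, up to signs, for
  the indefinite inner product of \<open>J\<close>, and \<open>1 - b(x) b(y)\<^sup>*\<close> is
  \<open>(1 - \<langle>\<nu>,\<nu>\<rangle>) (1 - \<langle>x,y\<rangle>) / ((1 - \<langle>x,\<nu>\<rangle>) (1 - \<langle>\<nu>,y\<rangle>))\<close>.  With \<open>K(x,y) = (I - G(x) G(y)\<^sup>*) / (1 - \<langle>x,y\<rangle>)\<close>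
  these facts give
  \<open>(P(x) P(y)\<^sup>* - Q(x) Q(y)\<^sup>*) / (1 - \<langle>x,y\<rangle>) = K(x,y) - K(x,\<nu>) \<xi> \<xi>\<^sup>* K(\<nu>,y) / (\<xi>\<^sup>* K(\<nu>,\<nu>) \<xi>)\<close>,
  a Schur complement in the positive kernel \<open>K\<close> and therefore itself positive
  (\<open>lft_kernel_identity\<close>, \<open>blaschke_kernel\<close>, \<open>psd_form_schur_complement\<close>).

  What remains is Leech's theorem for the Drury-Arveson kernel: if this kernel is positive, then
  \<open>P s = - Q\<close> has a Schur multiplier \<open>s\<close> as a solution.  Since the equation says that
  \<open>s(x)\<^sup>* P(x)\<^sup>* u = - Q(x)\<^sup>* u\<close> for all \<open>x\<close> and \<open>u\<close>, it is a tangential interpolation problem.  For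
  finitely many conditions it is solved by a lurking isometry between finite-dimensional spaces and
  its transfer function (\<open>lurking_isometry\<close>, \<open>tangential_pick_finite\<close>).  No infinite-dimensional space
  is needed for the general case: each condition on \<open>s\<close>, including each inequality that makes it a
  Schur multiplier, involves finitely many values of \<open>s\<close>, so Tychonoff's theorem applies
  (\<open>tangential_pick\<close>).

  Finally, orthogonality of the columns yields \<open>(D - B\<^sup>* G) (C s + D) = I\<close>, so that \<open>C s + D\<close> is
  invertible.
\<close>

section \<open>Matrices and adjoints\<close>

lemma adjoint_dim [simp]:
  "dim_row (mat_adjoint A) = dim_col A" "dim_col (mat_adjoint A) = dim_row A"
  by (simp_all add: mat_adjoint_def)

lemma adjoint_carrier [simp, intro]:
  "A \<in> carrier_mat m n \<Longrightarrow> mat_adjoint A \<in> carrier_mat n m"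
  by (rule carrier_matI) auto

lemma adjoint_index [simp]:
  "i < dim_col A \<Longrightarrow> j < dim_row A \<Longrightarrow> mat_adjoint A $$ (i, j) = conjugate (A $$ (j, i))"
  by (simp add: mat_adjoint_def mat_of_rows_def)

lemma mat_adjoint_adjoint [simp]: "mat_adjoint (mat_adjoint A) = (A :: complex mat)"
  by (rule eq_matI) auto

lemma mult_index_sum:
  "i < dim_row A \<Longrightarrow> j < dim_col B \<Longrightarrow> dim_col A = dim_row B \<Longrightarrow>
    (A * B) $$ (i, j) = (\<Sum>k<dim_row B. A $$ (i, k) * B $$ (k, j))"
  by (simp add: scalar_prod_def atLeast0LessThan)

lemma adjoint_mult:
  "dim_col A = dim_row B \<Longrightarrow> mat_adjoint (A * B) = mat_adjoint B * mat_adjoint (A :: complex mat)"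
  by (rule eq_matI)
     (auto simp: mult_index_sum conjugate_complex_def mult.commute simp del: index_mult_mat(1))

lemma adjoint_add:
  "dim_row A = dim_row B \<Longrightarrow> dim_col A = dim_col B \<Longrightarrow>
    mat_adjoint (A + B) = mat_adjoint A + mat_adjoint (B :: complex mat)"
  by (rule eq_matI) auto

lemma adjoint_minus:
  "dim_row A = dim_row B \<Longrightarrow> dim_col A = dim_col B \<Longrightarrow>
    mat_adjoint (A - B) = mat_adjoint A - mat_adjoint (B :: complex mat)"
  by (rule eq_matI) auto

lemma adjoint_smult: "mat_adjoint (a \<cdot>\<^sub>m A) = cnj a \<cdot>\<^sub>m mat_adjoint (A :: complex mat)"
  by (rule eq_matI) auto

lemma adjoint_one [simp]: "mat_adjoint (1\<^sub>m n :: complex mat) = 1\<^sub>m n"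
  by (rule eq_matI) auto

lemma adjoint_zero [simp]: "mat_adjoint (0\<^sub>m m n :: complex mat) = 0\<^sub>m n m"
  by (rule eq_matI) auto

text \<open>The ring laws for matrices, with side conditions on dimensions that the simplifier can
  discharge.\<close>

lemma mat_mult_assoc:
  "dim_col A = dim_row B \<Longrightarrow> dim_col B = dim_row C \<Longrightarrow> (A * B) * C = A * (B * (C :: complex mat))"
  by (rule assoc_mult_mat[of _ "dim_row A" "dim_row B" _ "dim_row C" _ "dim_col C"]) auto

lemma mat_distrib_left:
  "dim_col A = dim_row B \<Longrightarrow> dim_row B = dim_row C \<Longrightarrow> dim_col B = dim_col C \<Longrightarrow>
    A * (B + C) = A * B + A * (C :: complex mat)"
  by (rule mult_add_distrib_mat[of _ "dim_row A" "dim_row B" _ "dim_col C"]) auto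

lemma mat_distrib_right:
  "dim_col B = dim_row A \<Longrightarrow> dim_row B = dim_row C \<Longrightarrow> dim_col B = dim_col C \<Longrightarrow>
    (B + C) * A = B * A + C * (A :: complex mat)"
  by (rule add_mult_distrib_mat[of _ "dim_row B" "dim_row A" _ _ "dim_col A"]) auto

lemma mat_minus_left:
  "dim_col A = dim_row B \<Longrightarrow> dim_row B = dim_row C \<Longrightarrow> dim_col B = dim_col C \<Longrightarrow>
    A * (B - C) = A * B - A * (C :: complex mat)"
  by (rule mult_minus_distrib_mat[of _ "dim_row A" "dim_row B" _ "dim_col C"]) auto

lemma mat_minus_right:
  "dim_col B = dim_row A \<Longrightarrow> dim_row B = dim_row C \<Longrightarrow> dim_col B = dim_col C \<Longrightarrow>
    (B - C) * A = B * A - C * (A :: complex mat)"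
  by (rule minus_mult_distrib_mat[of _ "dim_row B" "dim_row A" _ _ "dim_col A"]) auto

lemma mat_smult_left: "dim_col A = dim_row B \<Longrightarrow> (k \<cdot>\<^sub>m A) * B = k \<cdot>\<^sub>m (A * (B :: complex mat))"
  by (rule mult_smult_assoc_mat[of _ "dim_row A" "dim_row B" _ "dim_col B"]) auto

lemma mat_smult_right: "dim_col A = dim_row B \<Longrightarrow> A * (k \<cdot>\<^sub>m B) = k \<cdot>\<^sub>m (A * (B :: complex mat))"
  by (rule mult_smult_distrib[of _ "dim_row A" "dim_row B" _ "dim_col B"]) auto

lemma mat_one_left: "dim_row A = n \<Longrightarrow> 1\<^sub>m n * A = (A :: complex mat)"
  by (rule left_mult_one_mat[of _ _ "dim_col A"]) auto

lemma mat_one_right: "dim_col A = n \<Longrightarrow> A * 1\<^sub>m n = (A :: complex mat)"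
  by (rule right_mult_one_mat[of _ "dim_row A"]) auto

lemma mat_smult_smult: "a \<cdot>\<^sub>m (b \<cdot>\<^sub>m A) = (a * b) \<cdot>\<^sub>m (A :: complex mat)"
  by (rule eq_matI) auto

lemmas mat_ring = mat_mult_assoc mat_distrib_left mat_distrib_right mat_minus_left mat_minus_right
  mat_smult_left mat_smult_right mat_one_left mat_one_right mat_smult_smult

lemmas adjoint_simps = adjoint_mult adjoint_add adjoint_minus adjoint_smult

lemma mat_zero_mult: "dim_row A = k \<Longrightarrow> 0\<^sub>m m k * A = 0\<^sub>m m (dim_col (A :: complex mat))"
  by (rule left_mult_zero_mat) auto

lemma mat_mult_zero: "dim_col A = k \<Longrightarrow> (A :: complex mat) * 0\<^sub>m k m = 0\<^sub>m (dim_row A) m"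
  by (rule right_mult_zero_mat) auto

lemma mat_minus_self: "A - A = 0\<^sub>m (dim_row A) (dim_col (A :: complex mat))"
  by (rule eq_matI) auto

lemma mat_minus_eq_0D:
  fixes A B :: "complex mat"
  assumes "A - B = 0\<^sub>m i j" "dim_row A = i" "dim_row B = i" "dim_col A = j" "dim_col B = j"
  shows "A = B"
proof (rule eq_matI)
  fix r c assume rc: "r < dim_row B" "c < dim_col B"
  have "(A - B) $$ (r, c) = 0\<^sub>m i j $$ (r, c)" by (simp only: assms(1))
  then show "A $$ (r, c) = B $$ (r, c)" using assms(2-) rc by simp
qed (use assms in auto)

text \<open>Products that contain a \<open>1 \<times> 1\<close> factor are scalar multiples.\<close>

lemma mult_entry_left:
  "dim_row A = 1 \<Longrightarrow> dim_col A = 1 \<Longrightarrow> dim_row B = 1 \<Longrightarrow> A * B = entry A \<cdot>\<^sub>m (B :: complex mat)"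
  by (rule eq_matI) (auto simp: mult_index_sum entry_def simp del: index_mult_mat(1))

lemma mult_entry_right:
  "dim_row A = 1 \<Longrightarrow> dim_col A = 1 \<Longrightarrow> dim_col B = 1 \<Longrightarrow> B * A = entry A \<cdot>\<^sub>m (B :: complex mat)"
  by (rule eq_matI) (auto simp: mult_index_sum entry_def simp del: index_mult_mat(1))

lemma entry_add: "dim_row B = 1 \<Longrightarrow> dim_col B = 1 \<Longrightarrow> entry (A + B) = entry A + entry B"
  by (simp add: entry_def)

lemma entry_minus: "dim_row B = 1 \<Longrightarrow> dim_col B = 1 \<Longrightarrow> entry (A - B) = entry A - entry B"
  by (simp add: entry_def)

lemma entry_smult: "dim_row A = 1 \<Longrightarrow> dim_col A = 1 \<Longrightarrow> entry (a \<cdot>\<^sub>m A) = a * entry A"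
  by (simp add: entry_def)

lemma entry_adjoint: "dim_row A = 1 \<Longrightarrow> dim_col A = 1 \<Longrightarrow> entry (mat_adjoint A) = cnj (entry A)"
  by (simp add: entry_def)

lemma entry_mult:
  "dim_row A = 1 \<Longrightarrow> dim_col A = 1 \<Longrightarrow> dim_row B = 1 \<Longrightarrow> dim_col B = 1 \<Longrightarrow>
    entry (A * B) = entry A * entry B"
  by (simp add: mult_entry_left entry_smult)

lemmas entry_simps = entry_add entry_minus entry_smult entry_adjoint

lemma entry_adjoint_mult:
  "dim_col a = 1 \<Longrightarrow> dim_col b = 1 \<Longrightarrow> dim_row a = n \<Longrightarrow> dim_row b = n \<Longrightarrow>
    entry (mat_adjoint a * b) = (\<Sum>k<n. cnj (a $$ (k, 0)) * b $$ (k, 0))"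
  by (simp add: entry_def mult_index_sum del: index_mult_mat(1))

lemma entry_adjoint_self_nonneg:
  "dim_col a = 1 \<Longrightarrow> 0 \<le> entry (mat_adjoint a * a)"
  unfolding entry_adjoint_mult[OF _ _ refl refl]
  by (intro sum_nonneg) (simp add: complex_is_Real_iff less_eq_complex_def)

lemma entry_adjoint_self_eq_0:
  assumes "dim_col a = 1" "entry (mat_adjoint a * a) = 0"
  shows "a = 0\<^sub>m (dim_row a) 1"
proof -
  have e: "cnj z * z = of_real ((cmod z)\<^sup>2)" for z
    by (metis complex_norm_square mult.commute)
  have "(\<Sum>k<dim_row a. (cmod (a $$ (k, 0)))\<^sup>2) = 0"
    using assms(2) unfolding entry_adjoint_mult[OF assms(1) assms(1) refl refl] e
    by (simp only: of_real_sum[symmetric] of_real_eq_0_iff)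
  then have "\<forall>k<dim_row a. a $$ (k, 0) = 0"
    by (subst (asm) sum_nonneg_eq_0_iff) auto
  then show ?thesis
    using assms(1) by (intro eq_matI) auto
qed

lemma mat_eq_columnsI:
  assumes "A \<in> carrier_mat m n" "B \<in> carrier_mat m n"
    and "\<And>v. v \<in> carrier_mat n 1 \<Longrightarrow> A * v = B * (v :: complex mat)"
  shows "A = B"
proof (rule eq_matI)
  fix i j assume i: "i < dim_row B" and j: "j < dim_col B"
  define v :: "complex mat" where "v = mat n 1 (\<lambda>(k, _). if k = j then 1 else 0)"
  have v: "v \<in> carrier_mat n 1" by (simp add: v_def)
  have e: "(C * v) $$ (i, 0) = C $$ (i, j)" if "C \<in> carrier_mat m n" for C
  proof -
    have "(C * v) $$ (i, 0) = (\<Sum>k<n. C $$ (i, k) * (if k = j then 1 else 0))"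
      using that i j assms(2) v by (subst mult_index_sum) (auto simp: v_def)
    also have "\<dots> = C $$ (i, j)"
      using j assms(2) by (simp add: if_distrib cong: if_cong)
    finally show ?thesis .
  qed
  show "A $$ (i, j) = B $$ (i, j)"
    using assms(3)[OF v] e[OF assms(1)] e[OF assms(2)] by simp
qed (use assms in auto)

lemma entry_unit_vector:
  fixes M :: "complex mat"
  assumes M: "M \<in> carrier_mat n n" and i: "i < n"
  defines "u \<equiv> mat n 1 (\<lambda>(k, _). if k = i then 1 else 0)"
  shows "entry (mat_adjoint u * (M * u)) = M $$ (i, i)"
proof -
  have ud [simp]: "dim_row u = n" "dim_col u = 1" by (simp_all add: u_def)
  have u: "u $$ (k, 0) = (if k = i then 1 else 0)" if "k < n" for k
    using that by (simp add: u_def)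
  have [simp]: "dim_row M = n" "dim_col M = n" using M by auto
  have "entry (mat_adjoint u * (M * u)) = (\<Sum>k<n. cnj (u $$ (k, 0)) * (M * u) $$ (k, 0))"
    by (rule entry_adjoint_mult) simp_all
  also have "\<dots> = (\<Sum>k<n. if k = i then (M * u) $$ (k, 0) else 0)"
    by (rule sum.cong) (auto simp: u simp del: index_mult_mat(1))
  also have "\<dots> = (M * u) $$ (i, 0)" using i by simp
  also have "\<dots> = (\<Sum>l<n. M $$ (i, l) * u $$ (l, 0))"
    using i by (subst mult_index_sum) auto
  also have "\<dots> = (\<Sum>l<n. if l = i then M $$ (i, l) else 0)"
    by (rule sum.cong) (auto simp: u)
  also have "\<dots> = M $$ (i, i)" using i by simp
  finally show ?thesis .
qed

lemma entry_sandwich: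
  fixes M :: "complex mat"
  assumes "dim_row M = n" "dim_col M = n" "dim_row u = n" "dim_col u = 1" "dim_row v = n" "dim_col v = 1"
  shows "entry (mat_adjoint u * M * v) = (\<Sum>k<n. \<Sum>l<n. cnj (u $$ (k, 0)) * M $$ (k, l) * v $$ (l, 0))"
proof -
  have "entry (mat_adjoint u * M * v) = entry (mat_adjoint u * (M * v))"
    using assms by (simp add: mat_ring)
  also have "\<dots> = (\<Sum>k<n. cnj (u $$ (k, 0)) * (M * v) $$ (k, 0))"
    by (rule entry_adjoint_mult) (use assms in simp_all)
  also have "\<dots> = (\<Sum>k<n. \<Sum>l<n. cnj (u $$ (k, 0)) * M $$ (k, l) * v $$ (l, 0))"
    using assms by (intro sum.cong refl)
      (simp add: mult_index_sum sum_distrib_left mult.assoc del: index_mult_mat(1))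
  finally show ?thesis .
qed

lemma invertible_if_injective:
  assumes A: "A \<in> carrier_mat n n"
    and inj: "\<And>v. v \<in> carrier_mat n 1 \<Longrightarrow> A * v = 0\<^sub>m n 1 \<Longrightarrow> v = (0\<^sub>m n 1 :: complex mat)"
  obtains B where "B \<in> carrier_mat n n" "B * A = 1\<^sub>m n" "A * B = 1\<^sub>m n"
proof -
  have "det A \<noteq> 0"
  proof
    assume "det A = 0"
    then obtain v where v: "v \<in> carrier_vec n" "v \<noteq> 0\<^sub>v n" "A *\<^sub>v v = 0\<^sub>v n"
      using det_0_iff_vec_prod_zero_field[OF A] by auto
    define w where "w = mat n 1 (\<lambda>(i, _). v $ i)"
    have w: "w \<in> carrier_mat n 1" by (simp add: w_def)
    have "A * w = 0\<^sub>m n 1"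
    proof (rule eq_matI)
      fix i j assume "i < dim_row (0\<^sub>m n 1 :: complex mat)" "j < dim_col (0\<^sub>m n 1 :: complex mat)"
      then have ij: "i < n" "j = 0" by auto
      have "(A * w) $$ (i, j) = (\<Sum>k<n. A $$ (i, k) * v $ k)"
        using A ij by (subst mult_index_sum) (auto simp: w_def)
      also have "\<dots> = (A *\<^sub>v v) $ i"
        using A v(1) ij by (simp add: scalar_prod_def atLeast0LessThan)
      finally show "(A * w) $$ (i, j) = 0\<^sub>m n 1 $$ (i, j)" using v(3) ij by simp
    qed (use A w in auto)
    then have w0: "w = 0\<^sub>m n 1" by (rule inj[OF w])
    have "v $ i = 0" if "i < n" for i
    proof -
      have "w $$ (i, 0) = v $ i" using that by (simp add: w_def)
      then show ?thesis using that by (simp add: w0)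
    qed
    then have "v = 0\<^sub>v n" using v(1) by (intro eq_vecI) auto
    then show False using v(2) by simp
  qed
  from det_non_zero_imp_unit[OF A this, of "()"] show thesis
    using that by (auto simp: Units_def ring_mat_def)
qed

lemma mat_inv_eqI:
  assumes A: "A \<in> carrier_mat n n" and B: "B \<in> carrier_mat n n" and BA: "B * A = 1\<^sub>m n"
  shows "mat_inv A = B"
proof -
  have AB: "A * B = 1\<^sub>m n" by (rule mat_mult_left_right_inverse[OF B A BA])
  then have "A \<in> Units (ring_mat TYPE(complex) n ())"
    using A B BA by (auto simp: Units_def ring_mat_def)
  then obtain C where C: "mat_inverse A = Some C"
    using mat_inverse(1)[OF A, where b = "()"] by (cases "mat_inverse A") auto
  then have CA: "C * A = 1\<^sub>m n" and Cc: "C \<in> carrier_mat n n"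
    using mat_inverse(2)[OF A] by auto
  have "C = C * (A * B)" using Cc by (simp add: AB)
  also have "\<dots> = B" using A B Cc by (simp add: assoc_mult_mat[symmetric, of _ n n _ n _ n] CA)
  finally show ?thesis by (simp add: mat_inv_def C)
qed

section \<open>Block rows and block columns\<close>

lemma append_rows_dim [simp]:
  "dim_row (A @\<^sub>r B) = dim_row A + dim_row B" "dim_col (A @\<^sub>r B) = dim_col (A :: complex mat)"
  by (simp_all add: append_rows_def)

lemma append_rows_index:
  assumes "i < dim_row A + dim_row B" "j < dim_col A" "dim_col A = dim_col (B :: complex mat)"
  shows "(A @\<^sub>r B) $$ (i, j) = (if i < dim_row A then A $$ (i, j) else B $$ (i - dim_row A, j))"
  using assms by (simp add: append_rows_def)

lemma sum_lessThan_add: "(\<Sum>i<m + n. f i) = (\<Sum>i<m. f i) + (\<Sum>i<n. f (m + i :: nat) :: complex)"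
  by (induction n) (simp_all add: add.assoc)

lemma append_rows_eqD:
  assumes "A @\<^sub>r B = C @\<^sub>r (D :: complex mat)" "dim_row A = dim_row C" "dim_row B = dim_row D"
    "dim_col A = n" "dim_col B = n" "dim_col C = n" "dim_col D = n"
  shows "A = C" "B = D"
proof -
  have e: "(A @\<^sub>r B) $$ (i, j) = (C @\<^sub>r D) $$ (i, j)" for i j by (simp only: assms(1))
  show "A = C"
  proof (rule eq_matI)
    fix i j assume "i < dim_row C" "j < dim_col C"
    then show "A $$ (i, j) = C $$ (i, j)"
      using e[of i j] assms(2-) by (simp add: append_rows_index)
  qed (use assms(2-) in auto)
  show "B = D"
  proof (rule eq_matI)
    fix i j assume "i < dim_row D" "j < dim_col D"
    then show "B $$ (i, j) = D $$ (i, j)"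
      using e[of "dim_row C + i" j] assms(2-) by (simp add: append_rows_index)
  qed (use assms(2-) in auto)
qed

lemma adjoint_append_rows_mult:
  assumes "dim_row A = dim_row C" "dim_row B = dim_row D" "dim_col A = dim_col B" "dim_col C = dim_col D"
  shows "mat_adjoint (A @\<^sub>r B) * (C @\<^sub>r D) = mat_adjoint A * C + mat_adjoint B * (D :: complex mat)"
proof (rule eq_matI)
  fix i j assume "i < dim_row (mat_adjoint A * C + mat_adjoint B * D)"
    "j < dim_col (mat_adjoint A * C + mat_adjoint B * D)"
  then have ij: "i < dim_col B" "j < dim_col D" by simp_all
  have "(mat_adjoint (A @\<^sub>r B) * (C @\<^sub>r D)) $$ (i, j)
      = (\<Sum>k<dim_row C + dim_row D. mat_adjoint (A @\<^sub>r B) $$ (i, k) * (C @\<^sub>r D) $$ (k, j))"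
    using ij assms by (subst mult_index_sum) auto
  also have "\<dots> = (\<Sum>k<dim_row C. mat_adjoint A $$ (i, k) * C $$ (k, j))
      + (\<Sum>k<dim_row D. mat_adjoint B $$ (i, k) * D $$ (k, j))"
    unfolding sum_lessThan_add using ij assms
    by (intro arg_cong2[of _ _ _ _ "(+)"] sum.cong) (auto simp: append_rows_index)
  also have "\<dots> = (mat_adjoint A * C + mat_adjoint B * D) $$ (i, j)"
    using ij assms by (simp add: mult_index_sum del: index_mult_mat(1))
  finally show "(mat_adjoint (A @\<^sub>r B) * (C @\<^sub>r D)) $$ (i, j)
      = (mat_adjoint A * C + mat_adjoint B * D) $$ (i, j)" .
qed (use assms in auto)

lemma four_block_mult_append_rows:
  assumes "A \<in> carrier_mat m n" "B \<in> carrier_mat m k" "C \<in> carrier_mat q n" "D \<in> carrier_mat q k"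
    and "v \<in> carrier_mat n c" "w \<in> carrier_mat k c"
  shows "four_block_mat A B C D * (v @\<^sub>r w) = (A * v + B * w) @\<^sub>r (C * v + D * (w :: complex mat))"
proof -
  have "four_block_mat A B C D * (v @\<^sub>r w) =
    four_block_mat (A * v + B * w) (A * 0\<^sub>m n 0 + B * 0\<^sub>m k 0) (C * v + D * w) (C * 0\<^sub>m n 0 + D * 0\<^sub>m k 0)"
    using assms unfolding append_rows_def
    by (subst mult_four_block_mat[OF assms(1-4), of _ c _ 0]) auto
  also have "A * 0\<^sub>m n 0 + B * 0\<^sub>m k 0 = 0\<^sub>m m 0"
    using assms by (intro eq_matI) auto
  also have "C * 0\<^sub>m n 0 + D * 0\<^sub>m k 0 = 0\<^sub>m q 0"
    using assms by (intro eq_matI) auto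
  finally show ?thesis using assms by (simp add: append_rows_def)
qed

lemma append_cols_dim [simp]:
  "dim_row (A @\<^sub>c B) = dim_row A" "dim_col (A @\<^sub>c B) = dim_col A + dim_col B"
  by (simp_all add: append_cols_def)

lemma append_cols_index:
  assumes "i < dim_row A" "j < dim_col A + dim_col B" "dim_row A = dim_row B"
  shows "(A @\<^sub>c B) $$ (i, j) = (if j < dim_col A then A $$ (i, j) else B $$ (i, j - dim_col A))"
  using assms by (simp add: append_cols_def)

lemma mult_append_cols:
  assumes "dim_col X = dim_row A" "dim_row A = dim_row B"
  shows "X * (A @\<^sub>c B) = (X * A) @\<^sub>c (X * B)"
proof (rule eq_matI)
  fix i j assume "i < dim_row ((X * A) @\<^sub>c (X * B))" "j < dim_col ((X * A) @\<^sub>c (X * B))"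
  then have ij: "i < dim_row X" "j < dim_col A + dim_col B" by simp_all
  have "(X * (A @\<^sub>c B)) $$ (i, j) = (\<Sum>k<dim_row A. X $$ (i, k) * (A @\<^sub>c B) $$ (k, j))"
    using ij assms by (subst mult_index_sum) auto
  also have "\<dots> = (\<Sum>k<dim_row A. X $$ (i, k) *
      (if j < dim_col A then A $$ (k, j) else B $$ (k, j - dim_col A)))"
    using ij assms by (intro sum.cong) (auto simp: append_cols_index)
  also have "\<dots> = ((X * A) @\<^sub>c (X * B)) $$ (i, j)"
    using ij assms by (subst append_cols_index) (auto simp: mult_index_sum simp del: index_mult_mat(1))
  finally show "(X * (A @\<^sub>c B)) $$ (i, j) = ((X * A) @\<^sub>c (X * B)) $$ (i, j)" .
qed simp_all

lemma append_cols_minus: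
  assumes "dim_row A = n" "dim_row B = n" "dim_row C = n" "dim_row D = n"
    "dim_col A = dim_col C" "dim_col B = dim_col D"
  shows "(A @\<^sub>c B) - (C @\<^sub>c D) = (A - C) @\<^sub>c (B - D)"
  using assms by (intro eq_matI) (auto simp: append_cols_index)

lemma append_cols_mult_adjoint:
  assumes "dim_row A = dim_row B" "dim_row C = dim_row D" "dim_col A = dim_col C" "dim_col B = dim_col D"
  shows "(A @\<^sub>c B) * mat_adjoint (C @\<^sub>c D) = A * mat_adjoint C + B * mat_adjoint D"
proof (rule eq_matI)
  fix i j assume "i < dim_row (A * mat_adjoint C + B * mat_adjoint D)"
    "j < dim_col (A * mat_adjoint C + B * mat_adjoint D)"
  then have ij: "i < dim_row B" "j < dim_row D" by simp_all
  have "((A @\<^sub>c B) * mat_adjoint (C @\<^sub>c D)) $$ (i, j)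
      = (\<Sum>k<dim_col C + dim_col D. (A @\<^sub>c B) $$ (i, k) * mat_adjoint (C @\<^sub>c D) $$ (k, j))"
    using ij assms by (subst mult_index_sum) auto
  also have "\<dots> = (\<Sum>k<dim_col C. A $$ (i, k) * mat_adjoint C $$ (k, j))
      + (\<Sum>k<dim_col D. B $$ (i, k) * mat_adjoint D $$ (k, j))"
    unfolding sum_lessThan_add using ij assms
    by (intro arg_cong2[of _ _ _ _ "(+)"] sum.cong) (auto simp: append_cols_index)
  also have "\<dots> = (A * mat_adjoint C + B * mat_adjoint D) $$ (i, j)"
    using ij assms by (simp add: mult_index_sum del: index_mult_mat(1))
  finally show "((A @\<^sub>c B) * mat_adjoint (C @\<^sub>c D)) $$ (i, j)
      = (A * mat_adjoint C + B * mat_adjoint D) $$ (i, j)" .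
qed (use assms in auto)

section \<open>Positive semidefinite forms\<close>

text \<open>Positive semidefiniteness of the array \<open>L i j\<close> with \<open>i, j < m\<close>, as a condition on all coefficient
  sequences \<open>c\<close>, of which only the first \<open>m\<close> entries matter.  It includes that the form is real.\<close>

definition psd_form :: "nat \<Rightarrow> (nat \<Rightarrow> nat \<Rightarrow> complex) \<Rightarrow> bool"
  where "psd_form m L \<longleftrightarrow> (\<forall>c. 0 \<le> (\<Sum>i<m. \<Sum>j<m. cnj (c i) * L i j * c j))"

lemma psd_formD: "psd_form m L \<Longrightarrow> 0 \<le> (\<Sum>i<m. \<Sum>j<m. cnj (c i) * L i j * c j)"
  by (simp add: psd_form_def)

lemma psd_form_cong: 
  "(\<And>i j. i < m \<Longrightarrow> j < m \<Longrightarrow> L i j = L' i j) \<Longrightarrow> psd_form m L = psd_form m L'"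
  by (simp add: psd_form_def)

lemma cnj_mult_self_nonneg: "0 \<le> cnj z * z"
  by (simp add: less_eq_complex_def)

lemma psd_form_one: "psd_form m (\<lambda>_ _. 1)"
  unfolding psd_form_def
proof
  fix c :: "nat \<Rightarrow> complex"
  have "(\<Sum>i<m. \<Sum>j<m. cnj (c i) * 1 * c j) = cnj (\<Sum>i<m. c i) * (\<Sum>i<m. c i)"
    by (simp add: sum_product)
  also have "\<dots> \<ge> 0" by (rule cnj_mult_self_nonneg)
  finally show "0 \<le> (\<Sum>i<m. \<Sum>j<m. cnj (c i) * 1 * c j)" .
qed

lemma psd_form_two_indices:
  assumes "psd_form m L" "i < m" "j < m"
  shows "0 \<le> cnj a * L i i * a + cnj a * L i j * b + cnj b * L j i * a + cnj b * L j j * b"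
proof -
  define c where "c k = (if k = i then a else 0) + (if k = j then b else 0)" for k
  have *: "(\<Sum>l<m. f l * c l) = f i * a + f j * b" for f :: "nat \<Rightarrow> complex"
  proof -
    have "(\<Sum>l<m. f l * c l)
        = (\<Sum>l<m. if l = i then f l * a else 0) + (\<Sum>l<m. if l = j then f l * b else 0)"
      unfolding sum.distrib[symmetric] by (rule sum.cong) (auto simp: c_def distrib_left)
    then show ?thesis using assms(2,3) by simp
  qed
  have **: "(\<Sum>l<m. cnj (c l) * f l) = cnj a * f i + cnj b * f j" for f :: "nat \<Rightarrow> complex"
  proof -
    have "(\<Sum>l<m. cnj (c l) * f l)
        = (\<Sum>l<m. if l = i then cnj a * f l else 0) + (\<Sum>l<m. if l = j then cnj b * f l else 0)"
      unfolding sum.distrib[symmetric] by (rule sum.cong) (auto simp: c_def distrib_right)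
    then show ?thesis using assms(2,3) by simp
  qed
  have "0 \<le> (\<Sum>k<m. \<Sum>l<m. cnj (c k) * L k l * c l)"
    by (rule psd_formD[OF assms(1)])
  also have "\<dots> = (\<Sum>k<m. cnj (c k) * (L k i * a + L k j * b))"
    by (simp only: mult.assoc sum_distrib_left[symmetric] *)
  also have "\<dots> = cnj a * (L i i * a + L i j * b) + cnj b * (L j i * a + L j j * b)"
    by (rule **)
  finally show ?thesis by (simp add: algebra_simps)
qed

lemma psd_form_diag: "psd_form m L \<Longrightarrow> i < m \<Longrightarrow> 0 \<le> L i i"
  using psd_form_two_indices[of m L i i 1 0] by simp

lemma psd_form_hermitian:
  assumes "psd_form m L" "i < m" "j < m"
  shows "L j i = cnj (L i j)"
proof -
  have d: "Im (L i i) = 0" "Im (L j j) = 0"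
    using psd_form_diag[OF assms(1)] assms(2,3) by (simp_all add: less_eq_complex_def)
  have "Im (L i j) + Im (L j i) = 0"
    using psd_form_two_indices[OF assms, of 1 1] d by (simp add: less_eq_complex_def)
  moreover have "Re (L i j) = Re (L j i)"
    using psd_form_two_indices[OF assms, of 1 \<i>] d by (simp add: less_eq_complex_def)
  ultimately show ?thesis by (simp add: complex_eq_iff)
qed

lemma psd_form_zero_diag:
  assumes "psd_form m L" "i < m" "j < m" "L j j = 0"
  shows "L i j = 0"
proof -
  define t where "t = Re (L i i)"
  have t: "L i i = of_real t" "0 \<le> t"
    using psd_form_diag[OF assms(1,2)] by (auto simp: t_def complex_eq_iff less_eq_complex_def)
  show ?thesis
  proof (rule ccontr)
    assume nz: "L i j \<noteq> 0"
    define s where "s = (t + 1) / (2 * (cmod (L i j))\<^sup>2)"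
    \<comment> \<open>the form at \<open>e\<^sub>i - s L j i e\<^sub>j\<close>, where \<open>s\<close> is large enough to make it negative\<close>
    have "0 \<le> of_real t - 2 * of_real s * (L i j * cnj (L i j))"
      using psd_form_two_indices[OF assms(1-3), of 1 "- of_real s * L j i"]
      by (simp add: assms(4) psd_form_hermitian[OF assms(1-3)] t algebra_simps)
    also have "\<dots> = of_real (t - 2 * s * (cmod (L i j))\<^sup>2)"
      by (simp add: complex_norm_square[symmetric])
    also have "t - 2 * s * (cmod (L i j))\<^sup>2 = -1"
      using nz by (simp add: s_def field_simps)
    finally show False by (simp add: less_eq_complex_def)
  qed
qed

text \<open>The Schur complement of the last diagonal entry.  If that entry vanishes then so does the last
  column, and the convention \<open>x / 0 = 0\<close> gives the right value.\<close>

lemma psd_form_schur_complement: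
  assumes "psd_form (Suc m) L"
  shows "psd_form m (\<lambda>i j. L i j - L i m * L m j / L m m)"
  unfolding psd_form_def
proof
  fix c :: "nat \<Rightarrow> complex"
  define y where "y = (\<Sum>j<m. L m j * c j)"
  \<comment> \<open>the last coefficient that minimizes the form\<close>
  define t where "t = - y / L m m"
  have cy: "(\<Sum>i<m. cnj (c i) * L i m) = cnj y"
    using psd_form_hermitian[OF assms, of m] by (simp add: y_def mult.commute)
  have r: "cnj (L m m) = L m m"
    using psd_form_hermitian[OF assms, of m m] by simp
  have "0 \<le> (\<Sum>i<Suc m. \<Sum>j<Suc m. cnj ((c(m := t)) i) * L i j * (c(m := t)) j)"
    by (rule psd_formD[OF assms])
  also have "\<dots> = (\<Sum>i<m. \<Sum>j<m. cnj (c i) * L i j * c j) + (\<Sum>i<m. cnj (c i) * L i m) * t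
      + cnj t * y + cnj t * L m m * t"
    by (simp add: sum.distrib sum_distrib_left sum_distrib_right y_def mult.assoc algebra_simps)
  also have "\<dots> = (\<Sum>i<m. \<Sum>j<m. cnj (c i) * L i j * c j) - cnj y * y / L m m"
    unfolding cy by (cases "L m m = 0") (simp_all add: t_def r field_simps)
  also have "cnj y * y / L m m
      = (\<Sum>i<m. \<Sum>j<m. cnj (c i) * (L i m * L m j / L m m) * c j)"
    unfolding cy[symmetric] unfolding y_def
    by (simp add: sum_product sum_divide_distrib mult.assoc)
  also have "(\<Sum>i<m. \<Sum>j<m. cnj (c i) * L i j * c j)
        - (\<Sum>i<m. \<Sum>j<m. cnj (c i) * (L i m * L m j / L m m) * c j)
      = (\<Sum>i<m. \<Sum>j<m. cnj (c i) * (L i j - L i m * L m j / L m m) * c j)"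
    by (simp add: sum_subtractf[symmetric] algebra_simps)
  finally show "0 \<le> (\<Sum>i<m. \<Sum>j<m. cnj (c i) * (L i j - L i m * L m j / L m m) * c j)" .
qed

text \<open>The Gram vectors are built by Cholesky factorization, that is, by induction with the Schur
  complement; the vectors of the complement are extended by the last column.\<close>

lemma psd_form_gram:
  assumes "psd_form m L"
  shows "\<exists>h. \<forall>i<m. \<forall>j<m. L i j = (\<Sum>k<m. cnj (h i k) * h j k)"
  using assms
proof (induction m arbitrary: L)
  case 0
  show ?case by simp
next
  case (Suc m)
  obtain h where h: "\<forall>i<m. \<forall>j<m. L i j - L i m * L m j / L m m = (\<Sum>k<m. cnj (h i k) * h j k)"
    using Suc.IH[OF psd_form_schur_complement[OF Suc.prems]] by blast
  define r where "r = Re (L m m)"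
  have r: "L m m = of_real r" "0 \<le> r"
    using psd_form_diag[OF Suc.prems, of m] by (auto simp: r_def complex_eq_iff less_eq_complex_def)
  have sq: "of_real (sqrt r) * of_real (sqrt r) = (of_real r :: complex)"
    using r(2) by (metis of_real_mult real_sqrt_mult_self abs_of_nonneg)
  define g where "g i k = (if k = m then L m i / of_real (sqrt r) else if i = m then 0 else h i k)"
    for i k
  have sy: "cnj (L m i) = L i m" if "i < Suc m" for i
    using psd_form_hermitian[OF Suc.prems that, of m] by simp
  have "L i j = (\<Sum>k<Suc m. cnj (g i k) * g j k)" if "i < Suc m" "j < Suc m" for i j
  proof -
    have last: "cnj (g i m) * g j m = L i m * L m j / L m m"
      using sy[OF that(1)] sq by (simp add: g_def r(1) del: of_real_mult)
    have z: "L i m = 0" "L m j = 0" if "r = 0"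
      using psd_form_zero_diag[OF Suc.prems \<open>i < Suc m\<close>, of m] sy[OF \<open>j < Suc m\<close>]
        psd_form_zero_diag[OF Suc.prems \<open>j < Suc m\<close>, of m] r(1) that by auto
    show ?thesis
    proof (cases "i < m \<and> j < m")
      case True
      then have "(\<Sum>k<m. cnj (g i k) * g j k) = L i j - L i m * L m j / L m m"
        using h by (simp add: g_def)
      then show ?thesis using last by simp
    next
      case False
      then have "i = m \<or> j = m" using that by auto
      then have "(\<Sum>k<m. cnj (g i k) * g j k) = 0" "L i m * L m j / L m m = L i j"
        using z r(1) by (auto simp: g_def)
      then show ?thesis using last by simp
    qed
  qed
  then show ?case by blast
qed

lemma psd_form_add:
  "psd_form m L \<Longrightarrow> psd_form m L' \<Longrightarrow> psd_form m (\<lambda>i j. L i j + L' i j)"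
  unfolding psd_form_def
  by (simp add: distrib_left distrib_right sum.distrib)

lemma psd_form_sum:
  "(\<And>k. k \<in> A \<Longrightarrow> psd_form m (L k)) \<Longrightarrow> psd_form m (\<lambda>i j. \<Sum>k\<in>A. L k i j)"
proof (induction A rule: infinite_finite_induct)
  case (insert x A)
  then show ?case using psd_form_add[of m "L x"] by simp
qed (simp_all add: psd_form_def)

lemma psd_form_congruence:
  assumes "psd_form m L"
  shows "psd_form m (\<lambda>i j. cnj (f i) * L i j * f j)"
  unfolding psd_form_def
proof
  fix c show "0 \<le> (\<Sum>i<m. \<Sum>j<m. cnj (c i) * (cnj (f i) * L i j * f j) * c j)"
    using psd_formD[OF assms, of "\<lambda>i. f i * c i"] by (simp add: mult_ac)
qed

lemma psd_form_LIMSEQ: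
  assumes "\<And>n. psd_form m (L n)"
    and "\<And>i j. i < m \<Longrightarrow> j < m \<Longrightarrow> (\<lambda>n. L n i j) \<longlonglongrightarrow> L' i j"
  shows "psd_form m L'"
  unfolding psd_form_def
proof
  fix c
  let ?q = "\<lambda>L. \<Sum>i<m. \<Sum>j<m. cnj (c i) * L i j * c j"
  have lim: "(\<lambda>n. ?q (L n)) \<longlonglongrightarrow> ?q L'"
    using assms(2) by (intro tendsto_intros) auto
  have n: "0 \<le> Re (?q (L n))" "Im (?q (L n)) = 0" for n
    using psd_formD[OF assms(1)[of n], of c] by (simp_all only: less_eq_complex_def zero_complex.sel)
  have "0 \<le> Re (?q L')"
    by (rule LIMSEQ_le_const[OF tendsto_Re[OF lim]]) (use n in auto)
  moreover have "(\<lambda>n. 0) \<longlonglongrightarrow> Im (?q L')"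
    using tendsto_Im[OF lim] by (simp only: n(2))
  then have "Im (?q L') = 0"
    by (simp only: LIMSEQ_const_iff)
  ultimately show "0 \<le> ?q L'" by (simp only: less_eq_complex_def zero_complex.sel)
qed

section \<open>Positive matrix kernels\<close>

text \<open>Positivity of matrix kernels in terms of scalar forms.\<close>

lemma positive_kernel_psd_form:
  assumes "positive_kernel r X K" "\<And>i. i < m \<Longrightarrow> x i \<in> X" "\<And>i. i < m \<Longrightarrow> u i \<in> carrier_mat r 1"
  shows "psd_form m (\<lambda>i j. entry (mat_adjoint (u i) * (K (x i) (x j) * u j)))"
  unfolding psd_form_def
proof
  fix c
  have K: "K (x i) (x j) \<in> carrier_mat r r" if "i < m" "j < m" for i j
    using assms that unfolding positive_kernel_def by blast
  have "0 \<le> (\<Sum>i<m. \<Sum>j<m. entry (mat_adjoint (c i \<cdot>\<^sub>m u i) * K (x i) (x j) * (c j \<cdot>\<^sub>m u j)))"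
    using assms unfolding positive_kernel_def by simp
  also have "\<dots> = (\<Sum>i<m. \<Sum>j<m. cnj (c i) * entry (mat_adjoint (u i) * (K (x i) (x j) * u j)) * c j)"
  proof (intro sum.cong refl)
    fix i j assume ij: "i \<in> {..<m}" "j \<in> {..<m}"
    then have [simp]: "dim_row (u i) = r" "dim_col (u i) = 1" "dim_row (u j) = r" "dim_col (u j) = 1"
      "dim_row (K (x i) (x j)) = r" "dim_col (K (x i) (x j)) = r"
      using assms(3)[of i] assms(3)[of j] K[of i j] by auto
    show "entry (mat_adjoint (c i \<cdot>\<^sub>m u i) * K (x i) (x j) * (c j \<cdot>\<^sub>m u j))
      = cnj (c i) * entry (mat_adjoint (u i) * (K (x i) (x j) * u j)) * c j"
      by (simp add: mat_ring adjoint_simps entry_simps)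
  qed
  finally show "0 \<le> (\<Sum>i<m. \<Sum>j<m. cnj (c i) * entry (mat_adjoint (u i) * (K (x i) (x j) * u j)) * c j)" .
qed

lemma positive_kernelI:
  assumes "\<And>z w. z \<in> X \<Longrightarrow> w \<in> X \<Longrightarrow> K z w \<in> carrier_mat r r"
    and "\<And>m x u. (\<And>i. i < m \<Longrightarrow> x i \<in> X) \<Longrightarrow> (\<And>i. i < m \<Longrightarrow> u i \<in> carrier_mat r 1) \<Longrightarrow>
      psd_form m (\<lambda>i j. entry (mat_adjoint (u i) * K (x i) (x j) * u j))"
  shows "positive_kernel r X K"
  unfolding positive_kernel_def
proof (intro conjI ballI allI impI)
  fix m and x :: "nat \<Rightarrow> 'a" and u :: "nat \<Rightarrow> complex mat"
  assume "\<forall>i<m. x i \<in> X \<and> u i \<in> carrier_mat r 1"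
  then have "psd_form m (\<lambda>i j. entry (mat_adjoint (u i) * K (x i) (x j) * u j))"
    by (intro assms(2)) auto
  from psd_formD[OF this, of "\<lambda>_. 1"]
  show "0 \<le> (\<Sum>i<m. \<Sum>j<m. entry (mat_adjoint (u i) * K (x i) (x j) * u j))" by simp
qed (use assms(1) in auto)

lemma positive_kernel_cong:
  assumes "\<And>z w. z \<in> X \<Longrightarrow> w \<in> X \<Longrightarrow> K z w = L z w"
  shows "positive_kernel r X K \<longleftrightarrow> positive_kernel r X L"
  using assms unfolding positive_kernel_def by (intro arg_cong2[of _ _ _ _ "(\<and>)"]) auto

lemma positive_kernel_add:
  assumes "positive_kernel r X K" "positive_kernel r X L"
  shows "positive_kernel r X (\<lambda>z w. K z w + L z w)"
proof (rule positive_kernelI)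
  fix m and x :: "nat \<Rightarrow> 'a" and u :: "nat \<Rightarrow> complex mat"
  assume x: "\<And>i. i < m \<Longrightarrow> x i \<in> X" and u: "\<And>i. i < m \<Longrightarrow> u i \<in> carrier_mat r 1"
  have "psd_form m (\<lambda>i j. entry (mat_adjoint (u i) * (K (x i) (x j) * u j))
      + entry (mat_adjoint (u i) * (L (x i) (x j) * u j)))"
    using assms x u by (intro psd_form_add positive_kernel_psd_form)
  also have "?this \<longleftrightarrow> psd_form m (\<lambda>i j. entry (mat_adjoint (u i) * (K (x i) (x j) + L (x i) (x j)) * u j))"
  proof (rule psd_form_cong)
    fix i j assume ij: "i < m" "j < m"
    have "K (x i) (x j) \<in> carrier_mat r r" "L (x i) (x j) \<in> carrier_mat r r"
      using assms x ij unfolding positive_kernel_def by blast+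
    then have [simp]: "dim_row (u i) = r" "dim_col (u i) = 1" "dim_row (u j) = r" "dim_col (u j) = 1"
      "dim_row (K (x i) (x j)) = r" "dim_col (K (x i) (x j)) = r"
      "dim_row (L (x i) (x j)) = r" "dim_col (L (x i) (x j)) = r"
      using u[of i] u[of j] ij by auto
    show "entry (mat_adjoint (u i) * (K (x i) (x j) * u j))
      + entry (mat_adjoint (u i) * (L (x i) (x j) * u j))
      = entry (mat_adjoint (u i) * (K (x i) (x j) + L (x i) (x j)) * u j)"
      by (simp add: mat_ring entry_simps)
  qed
  finally show "psd_form m (\<lambda>i j. entry (mat_adjoint (u i) * (K (x i) (x j) + L (x i) (x j)) * u j))" .
qed (use assms in \<open>auto simp: positive_kernel_def\<close>)

lemma positive_kernel_factor:
  assumes F: "\<And>z. z \<in> X \<Longrightarrow> F z \<in> carrier_mat f r"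
    and k: "\<And>m x. (\<And>i. i < m \<Longrightarrow> x i \<in> X) \<Longrightarrow> psd_form m (\<lambda>i j. k (x i) (x j))"
  shows "positive_kernel r X (\<lambda>z w. k z w \<cdot>\<^sub>m (mat_adjoint (F z) * F w))"
proof (rule positive_kernelI)
  show "k z w \<cdot>\<^sub>m (mat_adjoint (F z) * F w) \<in> carrier_mat r r" if "z \<in> X" "w \<in> X" for z w
    using F[OF that(1)] F[OF that(2)] by (intro carrier_matI) auto
next
  fix m and x :: "nat \<Rightarrow> 'a" and u :: "nat \<Rightarrow> complex mat"
  assume x: "\<And>i. i < m \<Longrightarrow> x i \<in> X" and u: "\<And>i. i < m \<Longrightarrow> u i \<in> carrier_mat r 1"
  have "psd_form m (\<lambda>i j. \<Sum>l<f. cnj ((F (x i) * u i) $$ (l, 0)) * k (x i) (x j) * (F (x j) * u j) $$ (l, 0))"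
    by (intro psd_form_sum psd_form_congruence k x)
  also have "?this \<longleftrightarrow> psd_form m (\<lambda>i j. entry (mat_adjoint (u i) * (k (x i) (x j) \<cdot>\<^sub>m (mat_adjoint (F (x i)) * F (x j))) * u j))"
  proof (rule psd_form_cong)
    fix i j assume ij: "i < m" "j < m"
    have [simp]: "dim_row (u i) = r" "dim_col (u i) = 1" "dim_row (u j) = r" "dim_col (u j) = 1"
      "dim_row (F (x i)) = f" "dim_col (F (x i)) = r" "dim_row (F (x j)) = f" "dim_col (F (x j)) = r"
      using u[of i] u[of j] F[OF x, of i] F[OF x, of j] ij by auto
    have "entry (mat_adjoint (u i) * (k (x i) (x j) \<cdot>\<^sub>m (mat_adjoint (F (x i)) * F (x j))) * u j)
      = k (x i) (x j) * entry (mat_adjoint (F (x i) * u i) * (F (x j) * u j))"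
      by (simp add: mat_ring adjoint_simps entry_simps)
    also have "\<dots> = k (x i) (x j) * (\<Sum>l<f. cnj ((F (x i) * u i) $$ (l, 0)) * (F (x j) * u j) $$ (l, 0))"
      by (subst entry_adjoint_mult[of _ _ f]) simp_all
    also have "\<dots> = (\<Sum>l<f. cnj ((F (x i) * u i) $$ (l, 0)) * k (x i) (x j) * (F (x j) * u j) $$ (l, 0))"
      by (simp add: sum_distrib_left mult_ac del: index_mult_mat(1))
    finally show "(\<Sum>l<f. cnj ((F (x i) * u i) $$ (l, 0)) * k (x i) (x j) * (F (x j) * u j) $$ (l, 0))
      = entry (mat_adjoint (u i) * (k (x i) (x j) \<cdot>\<^sub>m (mat_adjoint (F (x i)) * F (x j))) * u j)" by simp
  qed
  finally show "psd_form m (\<lambda>i j. entry (mat_adjoint (u i) * (k (x i) (x j) \<cdot>\<^sub>m (mat_adjoint (F (x i)) * F (x j))) * u j))" .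
qed

section \<open>The Drury-Arveson kernel\<close>

lemma row_inner_sum:
  assumes "x \<in> carrier_mat 1 N" "y \<in> carrier_mat 1 N"
  shows "row_inner x y = (\<Sum>k<N. x $$ (0, k) * cnj (y $$ (0, k)))"
  using assms unfolding row_inner_def entry_def
  by (subst mult_index_sum) (auto intro!: sum.cong)

lemma row_inner_commute:
  "x \<in> carrier_mat 1 N \<Longrightarrow> y \<in> carrier_mat 1 N \<Longrightarrow> row_inner y x = cnj (row_inner x y)"
  by (simp add: row_inner_sum mult.commute)

lemma row_inner_self:
  "x \<in> carrier_mat 1 N \<Longrightarrow> row_inner x x = of_real (\<Sum>k<N. (cmod (x $$ (0, k)))\<^sup>2)"
  by (simp add: row_inner_sum complex_norm_square del: of_real_power)

lemma unit_ball_carrier: "x \<in> unit_ball N \<Longrightarrow> x \<in> carrier_mat 1 N"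
  by (simp add: unit_ball_def)

lemma row_inner_norm_less_1:
  assumes "x \<in> unit_ball N" "y \<in> unit_ball N"
  shows "cmod (row_inner x y) < 1"
proof -
  note c = assms[THEN unit_ball_carrier]
  let ?n = "\<lambda>x :: complex mat. L2_set (\<lambda>k. cmod (x $$ (0, k))) {..<N}"
  have n: "?n x < 1" if "x \<in> unit_ball N" for x
    using that row_inner_self[OF unit_ball_carrier[OF that]]
    by (simp add: unit_ball_def L2_set_def real_sqrt_lt_1_iff)
  have "cmod (row_inner x y) \<le> (\<Sum>k<N. \<bar>cmod (x $$ (0, k))\<bar> * \<bar>cmod (y $$ (0, k))\<bar>)"
    unfolding row_inner_sum[OF c] by (rule order.trans[OF norm_sum]) (simp add: norm_mult)
  also have "\<dots> \<le> ?n x * ?n y" by (rule L2_set_mult_ineq)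
  also have "\<dots> \<le> ?n x * 1"
    using n[OF assms(2)] by (intro mult_left_mono) (auto simp: L2_set_nonneg)
  also have "\<dots> < 1" using n[OF assms(1)] by simp
  finally show ?thesis .
qed

lemma one_minus_row_inner_nonzero:
  "x \<in> unit_ball N \<Longrightarrow> y \<in> unit_ball N \<Longrightarrow> 1 - row_inner x y \<noteq> 0"
  using row_inner_norm_less_1[of x N y] by auto

lemma row_inner_self_real:
  "x \<in> carrier_mat 1 N \<Longrightarrow> row_inner x x = of_real (Re (row_inner x x))"
  by (simp add: row_inner_self)

lemma row_inner_self_ball:
  assumes "\<nu> \<in> unit_ball N"
  obtains n where "row_inner \<nu> \<nu> = of_real n" "n < 1"
  using row_inner_self_real[OF unit_ball_carrier[OF assms]] assms that by (auto simp: unit_ball_def)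

text \<open>The kernel is the geometric series of the powers of the inner product, and multiplication by the
  inner product, a sum of rank one kernels, preserves positivity.\<close>

lemma psd_form_drury_arveson:
  assumes "\<And>i. i < m \<Longrightarrow> x i \<in> unit_ball N"
  shows "psd_form m (\<lambda>i j. drury_arveson (x i) (x j))"
proof -
  let ?r = "\<lambda>i j. row_inner (x i) (x j)"
  note c = unit_ball_carrier[OF assms]
  have pw: "psd_form m (\<lambda>i j. ?r i j ^ n)" for n
  proof (induction n)
    case 0 show ?case using psd_form_one by simp
  next
    case (Suc n)
    have "psd_form m (\<lambda>i j. \<Sum>k<N. cnj (cnj (x i $$ (0, k))) * ?r i j ^ n * cnj (x j $$ (0, k)))"
      by (intro psd_form_sum psd_form_congruence Suc.IH)
    also have "?this \<longleftrightarrow> psd_form m (\<lambda>i j. ?r i j ^ Suc n)"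
    proof (rule psd_form_cong)
      fix i j assume "i < m" "j < m"
      note r = row_inner_sum[OF c c, OF this, symmetric]
      have "(\<Sum>k<N. cnj (cnj (x i $$ (0, k))) * ?r i j ^ n * cnj (x j $$ (0, k)))
          = (\<Sum>k<N. x i $$ (0, k) * cnj (x j $$ (0, k))) * ?r i j ^ n"
        unfolding sum_distrib_right by (simp add: mult_ac)
      then show "(\<Sum>k<N. cnj (cnj (x i $$ (0, k))) * ?r i j ^ n * cnj (x j $$ (0, k)))
          = ?r i j ^ Suc n"
        by (simp only: r power_Suc)
    qed
    finally show ?case .
  qed
  show ?thesis
  proof (rule psd_form_LIMSEQ)
    show "psd_form m (\<lambda>i j. \<Sum>l<n. ?r i j ^ l)" for n
      by (intro psd_form_sum pw)
    show "(\<lambda>n. \<Sum>l<n. ?r i j ^ l) \<longlonglongrightarrow> drury_arveson (x i) (x j)" if "i < m" "j < m" for i j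
      using geometric_sums[OF row_inner_norm_less_1[OF assms assms], OF that]
      by (simp add: sums_def drury_arveson_def)
  qed
qed

section \<open>Extending an isometry between finite families of vectors\<close>

text \<open>Two families of vectors with the same Gram matrix are matched by a partial isometry \<open>V\<close>.  The
  construction adds one pair of vectors at a time: the parts of \<open>d\<close> and \<open>e\<close> that are not yet
  accounted for, \<open>d - V\<^sup>* V d\<close> and \<open>e - V d\<close>, have the same norm.  The last conjunct is needed for
  the induction only.\<close>

lemma lurking_isometry:
  fixes d e :: "nat \<Rightarrow> complex mat"
  assumes "\<And>t. t < m \<Longrightarrow> d t \<in> carrier_mat k 1" "\<And>t. t < m \<Longrightarrow> e t \<in> carrier_mat l 1"
    and "\<And>s t. s < m \<Longrightarrow> t < m \<Longrightarrow> mat_adjoint (d s) * d t = mat_adjoint (e s) * e t"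
  shows "\<exists>V \<in> carrier_mat l k.
    (\<forall>t<m. V * d t = e t \<and> mat_adjoint V * e t = d t) \<and> V * (mat_adjoint V * V) = V \<and>
    (\<forall>v \<in> carrier_mat k 1. (\<forall>t<m. mat_adjoint (d t) * v = 0\<^sub>m 1 1) \<longrightarrow> V * v = 0\<^sub>m l 1)"
  using assms
proof (induction m)
  case 0
  show ?case
    by (rule bexI[of _ "0\<^sub>m l k"]) (auto simp: mat_zero_mult)
next
  case (Suc m)
  have "\<exists>V \<in> carrier_mat l k.
      (\<forall>t<m. V * d t = e t \<and> mat_adjoint V * e t = d t) \<and> V * (mat_adjoint V * V) = V \<and>
      (\<forall>v \<in> carrier_mat k 1. (\<forall>t<m. mat_adjoint (d t) * v = 0\<^sub>m 1 1) \<longrightarrow> V * v = 0\<^sub>m l 1)"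
    by (rule Suc.IH) (use Suc.prems in auto)
  then obtain V where V: "V \<in> carrier_mat l k"
    and IH: "(\<forall>t<m. V * d t = e t \<and> mat_adjoint V * e t = d t) \<and> V * (mat_adjoint V * V) = V \<and>
      (\<forall>v \<in> carrier_mat k 1. (\<forall>t<m. mat_adjoint (d t) * v = 0\<^sub>m 1 1) \<longrightarrow> V * v = 0\<^sub>m l 1)"
    by (rule bexE)
  have Vd: "V * d t = e t" and Ve: "mat_adjoint V * e t = d t" if "t < m" for t
    using IH that by simp_all
  have VVV: "V * (mat_adjoint V * V) = V"
    using IH by simp
  have V0: "V * v = 0\<^sub>m l 1"
    if "v \<in> carrier_mat k 1" "\<forall>t<m. mat_adjoint (d t) * v = 0\<^sub>m 1 1" for v
    using IH that by simp
  define d' where "d' = d m - mat_adjoint V * (V * d m)"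
  define e' where "e' = e m - V * d m"
  have dimV [simp]: "dim_row V = l" "dim_col V = k" using V by auto
  have dd [simp]: "dim_row (d t) = k" "dim_col (d t) = 1" "dim_row (e t) = l" "dim_col (e t) = 1"
    if "t < Suc m" for t
    using Suc.prems(1,2)[OF that] by auto
  have dd' [simp]: "dim_row d' = k" "dim_col d' = 1" "dim_row e' = l" "dim_col e' = 1"
    by (simp_all add: d'_def e'_def)
  have gram: "mat_adjoint (d s) * d t = mat_adjoint (e s) * e t" if "s < Suc m" "t < Suc m" for s t
    using Suc.prems(3)[OF that] .
  have VVV': "mat_adjoint V * (V * mat_adjoint V) = mat_adjoint V"
    using arg_cong[OF VVV, of mat_adjoint] by (simp add: adjoint_simps mat_ring)
  \<comment> \<open>\<open>d m - V\<^sup>* (e m)\<close> is orthogonal to all earlier \<open>d t\<close>, so \<open>V\<close> annihilates it\<close>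
  have Vdm: "V * d m = V * (mat_adjoint V * e m)"
  proof -
    have "mat_adjoint (d t) * (d m - mat_adjoint V * e m) = 0\<^sub>m 1 1" if "t < m" for t
    proof -
      have "mat_adjoint (d t) * (mat_adjoint V * e m) = mat_adjoint (V * d t) * e m"
        using that by (simp add: adjoint_simps mat_ring)
      then show ?thesis
        using that gram[of t m] by (simp add: mat_ring Vd mat_minus_self)
    qed
    then have "V * (d m - mat_adjoint V * e m) = 0\<^sub>m l 1"
      by (intro V0) (auto intro!: carrier_matI)
    then have "V * d m - V * (mat_adjoint V * e m) = 0\<^sub>m l 1"
      by (simp add: mat_ring)
    then show ?thesis by (rule mat_minus_eq_0D) auto
  qed
  have Vd': "V * d' = 0\<^sub>m l 1"
  proof -
    have "V * (mat_adjoint V * (V * d m)) = V * (mat_adjoint V * V) * d m"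
      by (simp add: mat_ring)
    then have "V * (mat_adjoint V * (V * d m)) = V * d m" by (simp add: VVV)
    then show ?thesis by (simp add: d'_def mat_ring mat_minus_self)
  qed
  have VVd: "mat_adjoint V * (V * d m) = mat_adjoint V * e m"
  proof -
    have "mat_adjoint V * (V * (mat_adjoint V * e m)) = mat_adjoint V * (V * mat_adjoint V) * e m"
      by (simp add: mat_ring)
    then show ?thesis by (simp add: VVV' Vdm)
  qed
  have Ve': "mat_adjoint V * e' = 0\<^sub>m k 1"
    by (simp add: e'_def mat_ring VVd mat_minus_self)
  have d'V: "mat_adjoint d' * mat_adjoint V = 0\<^sub>m 1 l"
    using arg_cong[OF Vd', of mat_adjoint] by (simp add: adjoint_simps)
  have e'V: "mat_adjoint e' * V = 0\<^sub>m 1 k"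
    using arg_cong[OF Ve', of mat_adjoint] by (simp add: adjoint_simps)
  \<comment> \<open>the two residuals have the same norm\<close>
  define r where "r = entry (mat_adjoint d' * d')"
  have d'd: "entry (mat_adjoint d' * d m) = r"
  proof -
    have "mat_adjoint d' * (mat_adjoint V * (V * d m)) = mat_adjoint d' * mat_adjoint V * (V * d m)"
      by (simp add: mat_ring)
    then have "mat_adjoint d' * (mat_adjoint V * (V * d m)) = 0\<^sub>m 1 1"
      by (simp add: d'V mat_zero_mult)
    then have "entry (mat_adjoint d' * (d m - mat_adjoint V * (V * d m)))
        = entry (mat_adjoint d' * d m)"
      by (simp add: mat_ring entry_simps) (simp add: entry_def)
    then show ?thesis by (simp add: r_def d'_def)
  qed
  have e'e': "entry (mat_adjoint e' * e') = entry (mat_adjoint e' * e m)"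
  proof -
    have "mat_adjoint e' * (V * d m) = mat_adjoint e' * V * d m"
      by (simp add: mat_ring)
    then have "mat_adjoint e' * (V * d m) = 0\<^sub>m 1 1"
      by (simp add: e'V mat_zero_mult)
    then have "entry (mat_adjoint e' * (e m - V * d m)) = entry (mat_adjoint e' * e m)"
      by (simp add: mat_ring entry_simps) (simp add: entry_def)
    then show ?thesis by (simp add: e'_def)
  qed
  have e'e: "entry (mat_adjoint e' * e m) = r"
  proof -
    have "mat_adjoint e' * e m = mat_adjoint (e m) * e m - mat_adjoint (d m) * (mat_adjoint V * e m)"
      by (simp add: e'_def adjoint_simps mat_ring)
    also have "mat_adjoint (d m) * (mat_adjoint V * e m) = mat_adjoint (mat_adjoint V * (V * d m)) * d m"
      by (simp add: adjoint_simps mat_ring VVd[symmetric])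
    also have "mat_adjoint (e m) * e m = mat_adjoint (d m) * d m"
      by (simp add: gram)
    also have "mat_adjoint (d m) * d m - mat_adjoint (mat_adjoint V * (V * d m)) * d m = mat_adjoint d' * d m"
      by (simp add: d'_def adjoint_simps mat_ring)
    finally show ?thesis using d'd by simp
  qed
  have r_real: "cnj r = r"
    using entry_adjoint[of "mat_adjoint d' * d'"] by (simp add: r_def adjoint_simps)
  have r0: "d' = 0\<^sub>m k 1" "e' = 0\<^sub>m l 1" if "r = 0"
    using entry_adjoint_self_eq_0[of d'] entry_adjoint_self_eq_0[of e'] that e'e e'e'
    by (auto simp: r_def)
  \<comment> \<open>if \<open>r = 0\<close> then there is nothing to add, and \<open>1 / 0 = 0\<close> leaves \<open>V\<close> unchanged\<close>
  define V' where "V' = V + (1 / r) \<cdot>\<^sub>m (e' * mat_adjoint d')"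
  have V'a: "mat_adjoint V' = mat_adjoint V + (1 / r) \<cdot>\<^sub>m (d' * mat_adjoint e')"
    by (simp add: V'_def adjoint_simps r_real)
  have dimV' [simp]: "dim_row V' = l" "dim_col V' = k" by (simp_all add: V'_def)
  have sc: "mat_adjoint d' * (d' * X) = r \<cdot>\<^sub>m X" "mat_adjoint e' * (e' * X) = r \<cdot>\<^sub>m X"
    if "dim_row X = 1" for X
    using that by (simp_all add: mat_mult_assoc[symmetric] mult_entry_left r_def[symmetric] e'e' e'e)
  show ?case
  proof (intro bexI conjI allI impI ballI)
    show "V' \<in> carrier_mat l k" by (rule carrier_matI) auto
  next
    fix t assume t: "t < Suc m"
    show "V' * d t = e t"
    proof (cases "t = m")
      case True
      have "(1 / r * r) \<cdot>\<^sub>m e' = e'"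
        using r0(2) by (cases "r = 0") (auto intro!: eq_matI)
      then have "V' * d t = V * d m + e'"
        using True d'd by (simp add: V'_def mat_ring mult_entry_right)
      also have "\<dots> = e m" by (rule eq_matI) (auto simp: e'_def simp del: index_mult_mat(1))
      finally show ?thesis using True by simp
    next
      case False
      then have t: "t < m" using t by simp
      have "mat_adjoint d' * d t = mat_adjoint (d m) * d t - mat_adjoint (d m) * (mat_adjoint V * (V * d t))"
        using t by (simp add: d'_def adjoint_simps mat_ring)
      then have "mat_adjoint d' * d t = 0\<^sub>m 1 1"
        using t by (simp add: Vd Ve mat_minus_self)
      then show ?thesis
        using t by (simp add: V'_def mat_ring Vd mat_mult_zero) (auto intro!: eq_matI)
    qed
    show "mat_adjoint V' * e t = d t"
    proof (cases "t = m")
      case True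
      have "(1 / r * r) \<cdot>\<^sub>m d' = d'"
        using r0(1) by (cases "r = 0") (auto intro!: eq_matI)
      then have "mat_adjoint V' * e t = mat_adjoint V * e m + d'"
        using True e'e by (simp add: V'a mat_ring mult_entry_right)
      also have "\<dots> = d m" by (rule eq_matI) (auto simp: d'_def VVd simp del: index_mult_mat(1))
      finally show ?thesis using True by simp
    next
      case False
      then have t: "t < m" using t by simp
      have "mat_adjoint e' * e t = mat_adjoint (e m) * e t - mat_adjoint (d m) * (mat_adjoint V * e t)"
        using t by (simp add: e'_def adjoint_simps mat_ring)
      then have "mat_adjoint e' * e t = 0\<^sub>m 1 1"
        using t gram[of m t] by (simp add: Ve mat_minus_self)
      then show ?thesis
        using t by (simp add: V'a mat_ring Ve mat_mult_zero) (auto intro!: eq_matI)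
    qed
  next
    have k3: "1 / r * (1 / r * r) = 1 / r" by simp
    have z1: "V * (d' * X) = 0\<^sub>m l (dim_col X)" if "dim_row X = 1" for X
      using that by (simp add: mat_mult_assoc[symmetric] Vd' mat_zero_mult)
    have z2: "mat_adjoint d' * (mat_adjoint V * X) = 0\<^sub>m 1 (dim_col X)" if "dim_row X = l" for X
      using that by (simp add: mat_mult_assoc[symmetric] d'V mat_zero_mult)
    have z3: "mat_adjoint V * (e' * X) = 0\<^sub>m k (dim_col X)" if "dim_row X = 1" for X
      using that by (simp add: mat_mult_assoc[symmetric] Ve' mat_zero_mult)
    have "mat_adjoint V' * V' = mat_adjoint V * V + (1 / r) \<cdot>\<^sub>m (d' * mat_adjoint d')"
      unfolding V'a unfolding V'_def
      by (simp add: mat_ring z3 sc e'V mat_mult_zero k3)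
         (auto intro!: eq_matI simp del: index_mult_mat(1))
    then show "V' * (mat_adjoint V' * V') = V'"
      by (simp only:) (simp add: V'_def mat_ring z1 z2 sc VVV mat_mult_zero k3,
        auto intro!: eq_matI simp del: index_mult_mat(1))
  next
    fix v :: "complex mat" assume v: "v \<in> carrier_mat k 1" and o: "\<forall>t<Suc m. mat_adjoint (d t) * v = 0\<^sub>m 1 1"
    have [simp]: "dim_row v = k" "dim_col v = 1" using v by auto
    have Vv: "V * v = 0\<^sub>m l 1" using V0[OF v] o by simp
    have "mat_adjoint d' * v = mat_adjoint (d m) * v - mat_adjoint (V * d m) * (V * v)"
      by (simp add: d'_def adjoint_simps mat_ring)
    then have "mat_adjoint d' * v = 0\<^sub>m 1 1"
      using o by (simp add: Vv mat_mult_zero)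
    then show "V' * v = 0\<^sub>m l 1"
      by (simp add: V'_def mat_ring Vv mat_mult_zero)
  qed
qed

text \<open>A partial isometry preserves inner products up to those of the components in its kernel.\<close>

lemma partial_isometry_defect:
  fixes V X Y :: "complex mat"
  assumes V: "V \<in> carrier_mat l k" and VVV: "V * (mat_adjoint V * V) = V"
    and XY: "dim_row X = k" "dim_row Y = k"
  defines "R \<equiv> 1\<^sub>m k - mat_adjoint V * V"
  shows "mat_adjoint X * Y = mat_adjoint (V * X) * (V * Y) + mat_adjoint (R * X) * (R * Y)"
proof -
  have [simp]: "dim_row V = l" "dim_col V = k" using V by auto
  have *: "V * (mat_adjoint V * (V * Z)) = V * Z" if "dim_row Z = k" for Z
  proof -
    have "V * (mat_adjoint V * V) * Z = V * (mat_adjoint V * (V * Z))"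
      using that by (simp add: mat_ring)
    then show ?thesis by (simp only: VVV)
  qed
  show ?thesis
    by (simp add: R_def mat_ring adjoint_simps XY *)
       (rule eq_matI, auto simp: XY simp del: index_mult_mat(1))
qed

section \<open>Tangential interpolation at finitely many points\<close>

text \<open>The Kronecker product of the column \<open>x\<^sup>*\<close> with the identity matrix of size \<open>r\<close>, where \<open>x\<close> is a
  row of length \<open>N\<close>.  Row \<open>k\<close> belongs to the coordinate \<open>k div r\<close> of \<open>x\<close>.\<close>

definition kron_id :: "nat \<Rightarrow> nat \<Rightarrow> complex mat \<Rightarrow> complex mat"
  where "kron_id N r x = mat (N * r) r (\<lambda>(k, j). if k mod r = j then cnj (x $$ (0, k div r)) else 0)"

lemma kron_id_dim [simp]: "dim_row (kron_id N r x) = N * r" "dim_col (kron_id N r x) = r"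
  by (simp_all add: kron_id_def)

lemma sum_div_mod:
  fixes N r :: nat and f :: "nat \<Rightarrow> nat \<Rightarrow> complex"
  shows "(\<Sum>k<N * r. f (k div r) (k mod r)) = (\<Sum>a<N. \<Sum>b<r. f a b)"
proof (induction N)
  case (Suc N)
  have "(\<Sum>k<Suc N * r. f (k div r) (k mod r)) = (\<Sum>k<N * r + r. f (k div r) (k mod r))"
    by (simp add: add.commute)
  also have "\<dots> = (\<Sum>a<N. \<Sum>b<r. f a b) + (\<Sum>b<r. f ((N * r + b) div r) ((N * r + b) mod r))"
    by (simp only: sum_lessThan_add Suc.IH)
  also have "(\<Sum>b<r. f ((N * r + b) div r) ((N * r + b) mod r)) = (\<Sum>b<r. f N b)"
    by (intro sum.cong) (auto simp: div_mult_self3)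
  finally show ?case by simp
qed simp

lemma kron_id_adjoint_mult:
  assumes "x \<in> carrier_mat 1 N" "y \<in> carrier_mat 1 N"
  shows "mat_adjoint (kron_id N r x) * kron_id N r y = row_inner x y \<cdot>\<^sub>m 1\<^sub>m r"
proof (rule eq_matI)
  fix i j assume "i < dim_row (row_inner x y \<cdot>\<^sub>m 1\<^sub>m r)" "j < dim_col (row_inner x y \<cdot>\<^sub>m 1\<^sub>m r)"
  then have ij: "i < r" "j < r" by simp_all
  have "(mat_adjoint (kron_id N r x) * kron_id N r y) $$ (i, j)
      = (\<Sum>k<N * r. (if k mod r = i then x $$ (0, k div r) else 0)
        * (if k mod r = j then cnj (y $$ (0, k div r)) else 0))"
    using ij by (subst mult_index_sum) (auto intro!: sum.cong simp: kron_id_def)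
  also have "\<dots> = (\<Sum>a<N. \<Sum>b<r. (if b = i then x $$ (0, a) else 0)
        * (if b = j then cnj (y $$ (0, a)) else 0))"
    by (rule sum_div_mod)
  also have "\<dots> = (\<Sum>a<N. if i = j then x $$ (0, a) * cnj (y $$ (0, a)) else 0)"
  proof (rule sum.cong)
    fix a
    have "(\<Sum>b<r. (if b = i then x $$ (0, a) else 0) * (if b = j then cnj (y $$ (0, a)) else 0))
        = (\<Sum>b<r. if b = i then (if i = j then x $$ (0, a) * cnj (y $$ (0, a)) else 0) else 0)"
      by (rule sum.cong) auto
    also have "\<dots> = (if i = j then x $$ (0, a) * cnj (y $$ (0, a)) else 0)"
      using ij by simp
    finally show "(\<Sum>b<r. (if b = i then x $$ (0, a) else 0) * (if b = j then cnj (y $$ (0, a)) else 0))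
        = (if i = j then x $$ (0, a) * cnj (y $$ (0, a)) else 0)" .
  qed simp
  also have "\<dots> = (row_inner x y \<cdot>\<^sub>m 1\<^sub>m r) $$ (i, j)"
    using ij by (simp add: row_inner_sum[OF assms])
  finally show "(mat_adjoint (kron_id N r x) * kron_id N r y) $$ (i, j)
      = (row_inner x y \<cdot>\<^sub>m 1\<^sub>m r) $$ (i, j)" .
qed simp_all

text \<open>The left tangential Nevanlinna-Pick theorem for the Drury-Arveson kernel.  Let \<open>h\<close> be Gram
  vectors of the positive array in the hypothesis.  Clearing the denominators shows that
  \<open>a t \<oplus> (x t)\<^sup>* \<otimes> h t\<close> and \<open>h t \<oplus> b t\<close> have the same Gram matrix, so a contractive block matrix
  \<open>V\<close> maps the former to the latter.  The adjoint of \<open>\<sigma> y\<close> is the transfer function of \<open>V\<close>: it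
  sends \<open>v\<close> to the \<open>u\<close> for which \<open>V (v \<oplus> y\<^sup>* \<otimes> g) = g \<oplus> u\<close> for some state \<open>g\<close>.\<close>

lemma tangential_pick_finite:
  fixes a b x :: "nat \<Rightarrow> complex mat" and m n q N :: nat
  assumes x: "\<And>t. t < m \<Longrightarrow> x t \<in> unit_ball N"
    and a: "\<And>t. t < m \<Longrightarrow> a t \<in> carrier_mat n 1"
    and b: "\<And>t. t < m \<Longrightarrow> b t \<in> carrier_mat q 1"
    and pos: "psd_form m (\<lambda>s t. drury_arveson (x s) (x t) *
      entry (mat_adjoint (a s) * a t - mat_adjoint (b s) * b t))"
  shows "\<exists>\<sigma>. schur_multiplier n q (unit_ball N) drury_arveson \<sigma> \<and>
    (\<forall>t<m. mat_adjoint (\<sigma> (x t)) * a t = b t)"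
proof -
  let ?K = "kron_id N m"
  obtain hh where hh: "\<forall>s<m. \<forall>t<m. drury_arveson (x s) (x t) *
      entry (mat_adjoint (a s) * a t - mat_adjoint (b s) * b t) = (\<Sum>k<m. cnj (hh s k) * hh t k)"
    using psd_form_gram[OF pos] by blast
  define h where "h t = mat m 1 (\<lambda>(k, _). hh t k)" for t
  have h_dim [simp]: "dim_row (h t) = m" "dim_col (h t) = 1" for t by (simp_all add: h_def)
  have ab_dim [simp]: "dim_row (a t) = n" "dim_col (a t) = 1" "dim_row (b t) = q" "dim_col (b t) = 1"
    if "t < m" for t
    using a[OF that] b[OF that] by auto
  have hh': "entry (mat_adjoint (h s) * h t) = (\<Sum>k<m. cnj (hh s k) * hh t k)" for s t
    by (subst entry_adjoint_mult[of _ _ m]) (simp_all add: h_def)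
  have kron: "mat_adjoint (?K y) * (?K z * X) = row_inner y z \<cdot>\<^sub>m X"
    if "y \<in> unit_ball N" "z \<in> unit_ball N" "dim_row X = m" for y z X
  proof -
    have "mat_adjoint (?K y) * (?K z * X) = mat_adjoint (?K y) * ?K z * X"
      using that by (simp add: mat_ring)
    then show ?thesis
      using that by (simp add: kron_id_adjoint_mult[OF that(1,2)[THEN unit_ball_carrier]] mat_ring)
  qed
  define d where "d t = a t @\<^sub>r (?K (x t) * h t)" for t
  define e where "e t = h t @\<^sub>r b t" for t
  have gram: "mat_adjoint (d s) * d t = mat_adjoint (e s) * e t" if st: "s < m" "t < m" for s t
  proof (rule eq_matI)
    fix i j assume "i < dim_row (mat_adjoint (e s) * e t)" "j < dim_col (mat_adjoint (e s) * e t)"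
    then have ij: "i = 0" "j = 0" using st by (simp_all add: e_def)
    have "entry (mat_adjoint (a s) * a t) - entry (mat_adjoint (b s) * b t)
        = (1 - row_inner (x s) (x t)) * entry (mat_adjoint (h s) * h t)"
    proof -
      have "(entry (mat_adjoint (a s) * a t) - entry (mat_adjoint (b s) * b t)) / (1 - row_inner (x s) (x t))
          = entry (mat_adjoint (h s) * h t)"
        unfolding hh' hh[rule_format, OF st, symmetric]
        using st by (simp add: drury_arveson_def entry_simps)
      then show ?thesis
        using one_minus_row_inner_nonzero[OF x x, OF st] by (simp add: divide_eq_eq mult.commute)
    qed
    then have "entry (mat_adjoint (d s) * d t) = entry (mat_adjoint (e s) * e t)"
      unfolding d_def e_def using st
      by (simp add: adjoint_append_rows_mult adjoint_simps mat_ring kron[OF x x] entry_simps algebra_simps)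
    then show "(mat_adjoint (d s) * d t) $$ (i, j) = (mat_adjoint (e s) * e t) $$ (i, j)"
      by (simp only: ij entry_def)
  qed (use that in \<open>simp_all add: d_def e_def\<close>)
  have "\<exists>V \<in> carrier_mat (m + q) (n + N * m).
    (\<forall>t<m. V * d t = e t \<and> mat_adjoint V * e t = d t) \<and> V * (mat_adjoint V * V) = V \<and>
    (\<forall>v \<in> carrier_mat (n + N * m) 1. (\<forall>t<m. mat_adjoint (d t) * v = 0\<^sub>m 1 1) \<longrightarrow> V * v = 0\<^sub>m (m + q) 1)"
    by (rule lurking_isometry)
       (use gram in \<open>auto simp: d_def e_def intro!: carrier_matI\<close>)
  then obtain V where V: "V \<in> carrier_mat (m + q) (n + N * m)"
    and Vd: "\<And>t. t < m \<Longrightarrow> V * d t = e t" and VVV: "V * (mat_adjoint V * V) = V"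
    by (elim bexE) simp
  define R where "R = 1\<^sub>m (n + N * m) - mat_adjoint V * V"
  have [simp]: "dim_row R = n + N * m" "dim_col R = n + N * m" using V by (simp_all add: R_def)
  note defect = partial_isometry_defect[OF V VVV, folded R_def]
  obtain V11 V12 V21 V22 where split: "split_block V m n = (V11, V12, V21, V22)"
    by (cases "split_block V m n") auto
  note blocks = split_block[OF split, of q "N * m"]
  have dV: "dim_row V = m + q" "dim_col V = n + N * m" using V by auto
  note B = blocks(1-4)[OF dV]
  have [simp]: "dim_row V11 = m" "dim_col V11 = n" "dim_row V12 = m" "dim_col V12 = N * m"
    "dim_row V21 = q" "dim_col V21 = n" "dim_row V22 = q" "dim_col V22 = N * m"
    using B by auto
  have Vapp: "V * (v @\<^sub>r w) = (V11 * v + V12 * w) @\<^sub>r (V21 * v + V22 * w)"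
    if "v \<in> carrier_mat n c" "w \<in> carrier_mat (N * m) c" for v w c
    using four_block_mult_append_rows[OF B that] blocks(5)[OF dV] by simp
  \<comment> \<open>the state equation is solvable: \<open>V\<close> is a contraction and \<open>y\<^sup>* \<otimes> I\<close> a strict one\<close>
  have inv: "\<exists>M. M \<in> carrier_mat m m \<and> M * (1\<^sub>m m - V12 * ?K y) = 1\<^sub>m m \<and> (1\<^sub>m m - V12 * ?K y) * M = 1\<^sub>m m"
    if y: "y \<in> unit_ball N" for y
  proof -
    have inj: "g = 0\<^sub>m m 1" if g: "g \<in> carrier_mat m 1" and "(1\<^sub>m m - V12 * ?K y) * g = 0\<^sub>m m 1" for g
    proof -
      have gd [simp]: "dim_row g = m" "dim_col g = 1" using g by auto
      have "g - V12 * (?K y * g) = 0\<^sub>m m 1"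
        using that(2) by (simp add: mat_ring)
      then have Wg: "V12 * (?K y * g) = g"
        by (rule mat_minus_eq_0D[symmetric]) auto
      define z where "z = 0\<^sub>m n 1 @\<^sub>r (?K y * g)"
      have zd [simp]: "dim_row z = n + N * m" "dim_col z = 1" by (simp_all add: z_def)
      have "V * z = g @\<^sub>r (V22 * (?K y * g))"
      proof -
        have "V * z = (V11 * 0\<^sub>m n 1 + V12 * (?K y * g)) @\<^sub>r (V21 * 0\<^sub>m n 1 + V22 * (?K y * g))"
          unfolding z_def by (rule Vapp) (auto intro!: carrier_matI)
        moreover have "V11 * 0\<^sub>m n 1 + V12 * (?K y * g) = g"
          unfolding Wg by (simp add: mat_mult_zero) (rule eq_matI, auto)
        moreover have "V21 * 0\<^sub>m n 1 + V22 * (?K y * g) = V22 * (?K y * g)"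
          by (simp add: mat_mult_zero) (rule eq_matI, auto simp del: index_mult_mat(1))
        ultimately show ?thesis by simp
      qed
      then have Vz: "entry (mat_adjoint (V * z) * (V * z)) = entry (mat_adjoint g * g)
          + entry (mat_adjoint (V22 * (?K y * g)) * (V22 * (?K y * g)))"
        by (simp add: adjoint_append_rows_mult entry_simps)
      have "entry (mat_adjoint z * z) = entry (mat_adjoint (?K y * g) * (?K y * g))"
        unfolding z_def by (simp add: adjoint_append_rows_mult mat_zero_mult entry_simps) (simp add: entry_def)
      also have "\<dots> = row_inner y y * entry (mat_adjoint g * g)"
        by (simp add: adjoint_simps mat_ring kron[OF y y] entry_simps)
      finally have zz: "entry (mat_adjoint z * z) = row_inner y y * entry (mat_adjoint g * g)" .
      have eq: "entry (mat_adjoint z * z) = entry (mat_adjoint (V * z) * (V * z))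
          + entry (mat_adjoint (R * z) * (R * z))"
        using arg_cong[OF defect[of z z], of entry] dV by (simp add: entry_simps)
      have "Re (entry (mat_adjoint g * g)) \<le> Re (row_inner y y * entry (mat_adjoint g * g))"
      proof -
        have "row_inner y y * entry (mat_adjoint g * g) = entry (mat_adjoint g * g)
            + entry (mat_adjoint (V22 * (?K y * g)) * (V22 * (?K y * g)))
            + entry (mat_adjoint (R * z) * (R * z))"
          using eq unfolding zz Vz .
        then show ?thesis
          using entry_adjoint_self_nonneg[of "R * z"] entry_adjoint_self_nonneg[of "V22 * (?K y * g)"]
          by (simp add: less_eq_complex_def del: times_complex.sel)
      qed
      moreover have gg: "entry (mat_adjoint g * g) = of_real (Re (entry (mat_adjoint g * g)))"
        "0 \<le> Re (entry (mat_adjoint g * g))"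
        using entry_adjoint_self_nonneg[of g] by (auto simp: less_eq_complex_def complex_eq_iff)
      moreover have "Re (row_inner y y) < 1" using y by (simp add: unit_ball_def)
      ultimately have "Re (entry (mat_adjoint g * g)) = 0"
      proof -
        let ?r = "Re (entry (mat_adjoint g * g))"
        have "?r \<le> Re (row_inner y y) * ?r"
          using \<open>?r \<le> Re (row_inner y y * entry (mat_adjoint g * g))\<close>
          by (subst (asm) (2) gg(1)) simp
        then have "(1 - Re (row_inner y y)) * ?r \<le> 0" by (simp add: algebra_simps)
        then show ?thesis
          using gg(2) \<open>Re (row_inner y y) < 1\<close> by (simp add: mult_le_0_iff)
      qed
      then show ?thesis
        using entry_adjoint_self_eq_0[of g] gg(1) by simp
    qed
    show ?thesis
      by (rule invertible_if_injective[of "1\<^sub>m m - V12 * ?K y" m])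
         (use inj in \<open>auto intro!: carrier_matI\<close>)
  qed
  define M where "M y = (SOME M. M \<in> carrier_mat m m \<and> M * (1\<^sub>m m - V12 * ?K y) = 1\<^sub>m m
      \<and> (1\<^sub>m m - V12 * ?K y) * M = 1\<^sub>m m)" for y
  have M: "M y \<in> carrier_mat m m" "M y * (1\<^sub>m m - V12 * ?K y) = 1\<^sub>m m"
    "(1\<^sub>m m - V12 * ?K y) * M y = 1\<^sub>m m" if "y \<in> unit_ball N" for y
    using someI_ex[OF inv[OF that]] by (simp_all add: M_def)
  have [simp]: "dim_row (M y) = m" "dim_col (M y) = m" if "y \<in> unit_ball N" for y
    using M(1)[OF that] by auto
  define \<Gamma> where "\<Gamma> y = M y * V11" for y
  define \<tau> where "\<tau> y = V21 + V22 * (?K y * \<Gamma> y)" for y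
  have \<Gamma>_dim [simp]: "dim_row (\<Gamma> y) = m" "dim_col (\<Gamma> y) = n" if "y \<in> unit_ball N" for y
    using that by (simp_all add: \<Gamma>_def)
  have \<tau>_dim [simp]: "dim_row (\<tau> y) = q" "dim_col (\<tau> y) = n" if "y \<in> unit_ball N" for y
    using that by (simp_all add: \<tau>_def)
  have \<Gamma>: "V11 + V12 * (?K y * \<Gamma> y) = \<Gamma> y" if y: "y \<in> unit_ball N" for y
  proof -
    have "(1\<^sub>m m - V12 * ?K y) * M y * V11 = V11"
      unfolding M(3)[OF y] by (simp add: mat_one_left)
    then have e: "\<Gamma> y - V12 * (?K y * \<Gamma> y) = V11"
      using y by (simp add: \<Gamma>_def mat_ring)
    show ?thesis
      unfolding e[symmetric] using y by (intro eq_matI) (auto simp del: index_mult_mat(1))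
  qed
  define Z where "Z y = 1\<^sub>m n @\<^sub>r (?K y * \<Gamma> y)" for y
  have Z_dim [simp]: "dim_row (Z y) = n + N * m" "dim_col (Z y) = n" for y
    by (simp_all add: Z_def)
  have VZ: "V * Z y = \<Gamma> y @\<^sub>r \<tau> y" if y: "y \<in> unit_ball N" for y
  proof -
    have "V * Z y = (V11 * 1\<^sub>m n + V12 * (?K y * \<Gamma> y)) @\<^sub>r (V21 * 1\<^sub>m n + V22 * (?K y * \<Gamma> y))"
      unfolding Z_def using y by (intro Vapp) (auto intro!: carrier_matI)
    then show ?thesis using y by (simp add: mat_ring \<Gamma> \<tau>_def)
  qed
  \<comment> \<open>compare inner products of \<open>Z y\<close> and \<open>Z z\<close> with those of their images under \<open>V\<close>\<close>
  have key: "drury_arveson y z \<cdot>\<^sub>m (1\<^sub>m n - mat_adjoint (\<tau> y) * \<tau> z)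
      = 1 \<cdot>\<^sub>m (mat_adjoint (\<Gamma> y) * \<Gamma> z)
        + drury_arveson y z \<cdot>\<^sub>m (mat_adjoint (R * Z y) * (R * Z z))"
    if y: "y \<in> unit_ball N" and z: "z \<in> unit_ball N" for y z
  proof -
    have "mat_adjoint (Z y) * Z z = mat_adjoint (V * Z y) * (V * Z z) + mat_adjoint (R * Z y) * (R * Z z)"
      by (rule defect) auto
    also have "mat_adjoint (V * Z y) * (V * Z z) = mat_adjoint (\<Gamma> y) * \<Gamma> z + mat_adjoint (\<tau> y) * \<tau> z"
      using y z by (simp add: VZ adjoint_append_rows_mult)
    also have "mat_adjoint (Z y) * Z z = 1\<^sub>m n + row_inner y z \<cdot>\<^sub>m (mat_adjoint (\<Gamma> y) * \<Gamma> z)"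
      unfolding Z_def using y z
      by (simp add: adjoint_append_rows_mult adjoint_simps mat_ring kron)
    finally have eq: "1\<^sub>m n + row_inner y z \<cdot>\<^sub>m (mat_adjoint (\<Gamma> y) * \<Gamma> z)
      = mat_adjoint (\<Gamma> y) * \<Gamma> z + mat_adjoint (\<tau> y) * \<tau> z + mat_adjoint (R * Z y) * (R * Z z)" .
    show ?thesis
    proof (rule eq_matI)
      fix i j
      let ?A = "mat_adjoint (\<Gamma> y) * \<Gamma> z" and ?B = "mat_adjoint (\<tau> y) * \<tau> z"
        and ?C = "mat_adjoint (R * Z y) * (R * Z z)"
      assume "i < dim_row (1 \<cdot>\<^sub>m ?A + drury_arveson y z \<cdot>\<^sub>m ?C)"
        "j < dim_col (1 \<cdot>\<^sub>m ?A + drury_arveson y z \<cdot>\<^sub>m ?C)"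
      then have ij: "i < n" "j < n" by simp_all
      have "(1\<^sub>m n + row_inner y z \<cdot>\<^sub>m ?A) $$ (i, j) = (?A + ?B + ?C) $$ (i, j)"
        by (simp only: eq)
      then have "1\<^sub>m n $$ (i, j) + row_inner y z * ?A $$ (i, j) = ?A $$ (i, j) + ?B $$ (i, j) + ?C $$ (i, j)"
        using ij y z by (simp del: index_mult_mat(1) index_one_mat(1))
      then have "1\<^sub>m n $$ (i, j) - ?B $$ (i, j) = (1 - row_inner y z) * ?A $$ (i, j) + ?C $$ (i, j)"
        by (simp add: algebra_simps)
      then have "drury_arveson y z * (1\<^sub>m n $$ (i, j) - ?B $$ (i, j)) = ?A $$ (i, j) + drury_arveson y z * ?C $$ (i, j)"
        using one_minus_row_inner_nonzero[OF y z] by (simp add: drury_arveson_def field_simps)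
      then show "(drury_arveson y z \<cdot>\<^sub>m (1\<^sub>m n - ?B)) $$ (i, j) = (1 \<cdot>\<^sub>m ?A + drury_arveson y z \<cdot>\<^sub>m ?C) $$ (i, j)"
        using ij y z by (simp del: index_mult_mat(1) index_one_mat(1))
    qed (use y z in auto)
  qed
  have "positive_kernel n (unit_ball N) (\<lambda>y z. 1 \<cdot>\<^sub>m (mat_adjoint (\<Gamma> y) * \<Gamma> z)
        + drury_arveson y z \<cdot>\<^sub>m (mat_adjoint (R * Z y) * (R * Z z)))"
  proof (intro positive_kernel_add)
    show "positive_kernel n (unit_ball N) (\<lambda>y z. 1 \<cdot>\<^sub>m (mat_adjoint (\<Gamma> y) * \<Gamma> z))"
      by (rule positive_kernel_factor[where f = m]) (auto intro!: carrier_matI psd_form_one)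
    show "positive_kernel n (unit_ball N) (\<lambda>y z. drury_arveson y z \<cdot>\<^sub>m (mat_adjoint (R * Z y) * (R * Z z)))"
      by (rule positive_kernel_factor[where f = "n + N * m"])
         (auto intro!: carrier_matI psd_form_drury_arveson)
  qed
  then have pk: "positive_kernel n (unit_ball N) (\<lambda>y z. drury_arveson y z \<cdot>\<^sub>m
      (1\<^sub>m n - mat_adjoint (\<tau> y) * mat_adjoint (mat_adjoint (\<tau> z))))"
    by (rule positive_kernel_cong[THEN iffD1, rotated]) (simp add: key)
  have schur: "schur_multiplier n q (unit_ball N) drury_arveson (\<lambda>y. mat_adjoint (\<tau> y))"
    unfolding schur_multiplier_def
  proof (intro conjI ballI)
    show "mat_adjoint (\<tau> y) \<in> carrier_mat n q" if "y \<in> unit_ball N" for y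
      using that by (intro carrier_matI) simp_all
  qed (rule pk)
  have interp: "\<tau> (x t) * a t = b t" if t: "t < m" for t
  proof -
    note xt = x[OF t]
    have "(V11 * a t + V12 * (?K (x t) * h t)) @\<^sub>r (V21 * a t + V22 * (?K (x t) * h t)) = h t @\<^sub>r b t"
    proof -
      have "V * (a t @\<^sub>r (?K (x t) * h t))
          = (V11 * a t + V12 * (?K (x t) * h t)) @\<^sub>r (V21 * a t + V22 * (?K (x t) * h t))"
        using a[OF t] by (intro Vapp[of _ 1] carrier_matI) auto
      then show ?thesis using Vd[OF t] by (simp only: d_def e_def)
    qed
    from append_rows_eqD[OF this, of 1]
    have 1: "V11 * a t + V12 * (?K (x t) * h t) = h t"
      and 2: "V21 * a t + V22 * (?K (x t) * h t) = b t"
      using t by simp_all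
    have "(1\<^sub>m m - V12 * ?K (x t)) * h t = V11 * a t"
    proof -
      have "(1\<^sub>m m - V12 * ?K (x t)) * h t = h t - V12 * (?K (x t) * h t)"
        by (simp add: mat_ring)
      also have "\<dots> = V11 * a t"
        by (subst (1) 1[symmetric]) (use t in \<open>auto intro!: eq_matI simp del: index_mult_mat(1)\<close>)
      finally show ?thesis .
    qed
    then have "M (x t) * ((1\<^sub>m m - V12 * ?K (x t)) * h t) = \<Gamma> (x t) * a t"
      using xt t by (simp add: \<Gamma>_def mat_mult_assoc)
    moreover have "M (x t) * ((1\<^sub>m m - V12 * ?K (x t)) * h t) = h t"
      using xt M(2)[OF xt] by (simp add: mat_mult_assoc[symmetric] mat_one_left)
    ultimately have "h t = \<Gamma> (x t) * a t" by simp
    then show ?thesis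
      using 2 xt t by (simp add: \<tau>_def mat_ring)
  qed
  show ?thesis
    using schur interp by (intro exI[of _ "\<lambda>y. mat_adjoint (\<tau> y)"]) simp
qed

section \<open>Tangential interpolation on arbitrary sets\<close>

lemma schur_multiplier_entry_le_1:
  assumes s: "schur_multiplier n q (unit_ball N) drury_arveson \<sigma>"
    and z: "z \<in> unit_ball N" and ij: "i < n" "j < q"
  shows "cmod (\<sigma> z $$ (i, j)) \<le> 1"
proof -
  let ?K = "\<lambda>z w. drury_arveson z w \<cdot>\<^sub>m (1\<^sub>m n - \<sigma> z * mat_adjoint (\<sigma> w))"
  define u :: "complex mat" where "u = mat n 1 (\<lambda>(k, _). if k = i then 1 else 0)"
  have c: "\<sigma> z \<in> carrier_mat n q" and pk: "positive_kernel n (unit_ball N) ?K"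
    using s z by (auto simp: schur_multiplier_def)
  have sd [simp]: "dim_row (\<sigma> z) = n" "dim_col (\<sigma> z) = q" using c by auto
  have "psd_form 1 (\<lambda>_ _. entry (mat_adjoint u * (?K z z * u)))"
    by (rule positive_kernel_psd_form[OF pk, of 1 "\<lambda>_. z" "\<lambda>_. u"])
       (use z in \<open>auto simp: u_def\<close>)
  from psd_form_diag[OF this, of 0] have "0 \<le> entry (mat_adjoint u * (?K z z * u))" by simp
  also have "\<dots> = ?K z z $$ (i, i)"
    unfolding u_def by (rule entry_unit_vector) (use ij in \<open>auto intro!: carrier_matI\<close>)
  also have "\<dots> = drury_arveson z z * (1 - (\<sigma> z * mat_adjoint (\<sigma> z)) $$ (i, i))"
    using ij by (simp del: index_mult_mat(1))
  also have "(\<sigma> z * mat_adjoint (\<sigma> z)) $$ (i, i) = (\<Sum>k<q. \<sigma> z $$ (i, k) * cnj (\<sigma> z $$ (i, k)))"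
    using ij by (subst mult_index_sum) auto
  also have "\<dots> = of_real (\<Sum>k<q. (cmod (\<sigma> z $$ (i, k)))\<^sup>2)"
    by (simp add: complex_norm_square del: of_real_power)
  finally have p: "0 \<le> drury_arveson z z * (1 - of_real (\<Sum>k<q. (cmod (\<sigma> z $$ (i, k)))\<^sup>2))" .
  define r where "r = Re (row_inner z z)"
  have r: "row_inner z z = of_real r" "r < 1"
    using row_inner_self_real[OF unit_ball_carrier[OF z]] z by (simp_all add: r_def unit_ball_def)
  have "drury_arveson z z * (1 - of_real (\<Sum>k<q. (cmod (\<sigma> z $$ (i, k)))\<^sup>2))
      = of_real (1 / (1 - r) * (1 - (\<Sum>k<q. (cmod (\<sigma> z $$ (i, k)))\<^sup>2)))"
    by (simp only: drury_arveson_def r of_real_mult of_real_divide of_real_diff of_real_1)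
  with p have "0 \<le> 1 / (1 - r) * (1 - (\<Sum>k<q. (cmod (\<sigma> z $$ (i, k)))\<^sup>2))"
    by (simp only: less_eq_complex_def Re_complex_of_real zero_complex.sel)
  then have "(\<Sum>k<q. (cmod (\<sigma> z $$ (i, k)))\<^sup>2) \<le> 1"
    using r(2) by (simp add: zero_le_divide_iff)
  moreover have "(cmod (\<sigma> z $$ (i, j)))\<^sup>2 \<le> (\<Sum>k<q. (cmod (\<sigma> z $$ (i, k)))\<^sup>2)"
    using ij by (intro member_le_sum) auto
  ultimately have "(cmod (\<sigma> z $$ (i, j)))\<^sup>2 \<le> 1\<^sup>2" by simp
  then show ?thesis by (rule power2_le_imp_le) simp
qed

lemma compact_unit_polydisc: "compact {f :: 'k \<Rightarrow> complex. \<forall>k. f k \<in> cball 0 1}"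
proof -
  have "compactin (product_topology (\<lambda>_ :: 'k. euclidean) UNIV) (PiE UNIV (\<lambda>_. cball (0 :: complex) 1))"
    by (subst compactin_PiE) auto
  then have "compact (PiE UNIV (\<lambda>_ :: 'k. cball (0 :: complex) 1))"
    by (simp add: euclidean_product_topology)
  also have "PiE UNIV (\<lambda>_ :: 'k. cball (0 :: complex) 1) = {f. \<forall>k. f k \<in> cball 0 1}"
    by (auto simp: PiE_def Pi_def)
  finally show ?thesis .
qed

text \<open>A matrix function, given by the family of its entries: spaces of such families carry the product
  topology.\<close>

definition mat_function ::
    "nat \<Rightarrow> nat \<Rightarrow> (complex mat \<times> nat \<times> nat \<Rightarrow> complex) \<Rightarrow> complex mat \<Rightarrow> complex mat"
  where "mat_function n q f z = mat n q (\<lambda>(i, j). f (z, i, j))"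

lemma mat_function_simps [simp]:
  "dim_row (mat_function n q f z) = n" "dim_col (mat_function n q f z) = q"
  "i < n \<Longrightarrow> j < q \<Longrightarrow> mat_function n q f z $$ (i, j) = f (z, i, j)"
  by (simp_all add: mat_function_def)

text \<open>Being a Schur multiplier is a closed condition for pointwise convergence, because each of its
  inequalities involves finitely many values of the function.\<close>

lemma closed_schur_multipliers:
  "closed {f. schur_multiplier n q X k (mat_function n q f)}"
proof -
  define \<Phi> where "\<Phi> m x u f = (\<Sum>i<m. \<Sum>j<m. \<Sum>a<n. \<Sum>b<n. cnj (u i $$ (a, 0)) *
      (k (x i) (x j) * ((if a = b then 1 else 0) - (\<Sum>c<q. f (x i, a, c) * cnj (f (x j, b, c)))))
      * u j $$ (b, 0))"
    for m :: nat and x :: "nat \<Rightarrow> complex mat" and u :: "nat \<Rightarrow> complex mat" and f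
  have \<Phi>: "(\<Sum>i<m. \<Sum>j<m. entry (mat_adjoint (u i) * (k (x i) (x j) \<cdot>\<^sub>m
      (1\<^sub>m n - mat_function n q f (x i) * mat_adjoint (mat_function n q f (x j)))) * u j)) = \<Phi> m x u f"
    if "\<forall>i<m. x i \<in> X \<and> u i \<in> carrier_mat n 1" for m x u f
    unfolding \<Phi>_def
  proof (intro sum.cong refl)
    fix i j assume "i \<in> {..<m}" "j \<in> {..<m}"
    then have [simp]: "dim_row (u i) = n" "dim_col (u i) = 1" "dim_row (u j) = n" "dim_col (u j) = 1"
      using that by auto
    show "entry (mat_adjoint (u i) * (k (x i) (x j) \<cdot>\<^sub>m
      (1\<^sub>m n - mat_function n q f (x i) * mat_adjoint (mat_function n q f (x j)))) * u j)
      = (\<Sum>a<n. \<Sum>b<n. cnj (u i $$ (a, 0)) *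
      (k (x i) (x j) * ((if a = b then 1 else 0) - (\<Sum>c<q. f (x i, a, c) * cnj (f (x j, b, c)))))
      * u j $$ (b, 0))"
      by (subst entry_sandwich[of _ n])
         (auto intro!: sum.cong simp: mult_index_sum simp del: index_mult_mat(1))
  qed
  have cont: "continuous_on UNIV (\<Phi> m x u)" for m x u
    unfolding \<Phi>_def
    by (intro continuous_intros continuous_on_product_coordinates)
  have "{f. schur_multiplier n q X k (mat_function n q f)} =
    {f. \<forall>m x u. (\<forall>i<m. x i \<in> X \<and> u i \<in> carrier_mat n 1) \<longrightarrow> 0 \<le> Re (\<Phi> m x u f) \<and> Im (\<Phi> m x u f) = 0}"
    (is "?L = ?R")
  proof -
    have "schur_multiplier n q X k (mat_function n q f) \<longleftrightarrow>
      (\<forall>m x u. (\<forall>i<m. x i \<in> X \<and> u i \<in> carrier_mat n 1) \<longrightarrow> 0 \<le> \<Phi> m x u f)" for f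
    proof (intro iffI allI impI)
      fix m :: nat and x u :: "nat \<Rightarrow> complex mat"
      assume s: "schur_multiplier n q X k (mat_function n q f)"
        and xu: "\<forall>i<m. x i \<in> X \<and> u i \<in> carrier_mat n 1"
      then show "0 \<le> \<Phi> m x u f"
        unfolding \<Phi>[OF xu, symmetric] schur_multiplier_def positive_kernel_def by simp
    next
      assume *: "\<forall>m x u. (\<forall>i<m. x i \<in> X \<and> u i \<in> carrier_mat n 1) \<longrightarrow> 0 \<le> \<Phi> m x u f"
      show "schur_multiplier n q X k (mat_function n q f)"
        unfolding schur_multiplier_def positive_kernel_def
      proof (intro conjI ballI allI impI)
        fix m :: nat and x u :: "nat \<Rightarrow> complex mat"
        assume xu: "\<forall>i<m. x i \<in> X \<and> u i \<in> carrier_mat n 1"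
        show "0 \<le> (\<Sum>i<m. \<Sum>j<m. entry (mat_adjoint (u i) * (k (x i) (x j) \<cdot>\<^sub>m
          (1\<^sub>m n - mat_function n q f (x i) * mat_adjoint (mat_function n q f (x j)))) * u j))"
          unfolding \<Phi>[OF xu] using * xu by blast
      qed (auto intro!: carrier_matI)
    qed
    moreover have "0 \<le> w \<longleftrightarrow> 0 \<le> Re w \<and> Im w = 0" for w :: complex
      by (auto simp: less_eq_complex_def)
    ultimately show ?thesis by (simp only:)
  qed
  also have "closed \<dots>"
  proof -
    have c: "closed {f. 0 \<le> Re (\<Phi> m x u f) \<and> Im (\<Phi> m x u f) = 0}" for m x u
      by (intro closed_Collect_conj closed_Collect_le closed_Collect_eq continuous_intros cont)
    show ?thesis
      unfolding Collect_all_eq imp_conv_disj Collect_disj_eq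
      by (intro closed_INT ballI closed_Un closed_Collect_const c)
  qed
  finally show ?thesis .
qed

text \<open>Entries of Schur multipliers lie in the unit disc, so compactness of the unit polydisc reduces
  interpolation along an arbitrary family of directions to finitely many.\<close>

lemma tangential_pick:
  fixes a b x :: "'i \<Rightarrow> complex mat" and n q N :: nat
  assumes x: "\<And>t. t \<in> I \<Longrightarrow> x t \<in> unit_ball N"
    and a: "\<And>t. t \<in> I \<Longrightarrow> a t \<in> carrier_mat n 1"
    and b: "\<And>t. t \<in> I \<Longrightarrow> b t \<in> carrier_mat q 1"
    and pos: "\<And>m f. (\<And>i. i < m \<Longrightarrow> f i \<in> I) \<Longrightarrow>
      psd_form m (\<lambda>i j. drury_arveson (x (f i)) (x (f j)) *
        entry (mat_adjoint (a (f i)) * a (f j) - mat_adjoint (b (f i)) * b (f j)))"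
  shows "\<exists>\<sigma>. schur_multiplier n q (unit_ball N) drury_arveson \<sigma> \<and>
    (\<forall>t\<in>I. mat_adjoint (\<sigma> (x t)) * a t = b t)"
proof -
  define P where "P = {f :: complex mat \<times> nat \<times> nat \<Rightarrow> complex. \<forall>k. f k \<in> cball 0 1}"
  define A where "A t = {f. mat_adjoint (mat_function n q f (x t)) * a t = b t}" for t
  define S where "S = {f. schur_multiplier n q (unit_ball N) drury_arveson (mat_function n q f)}"
  have cl: "closed (A t)" if t: "t \<in> I" for t
  proof -
    have [simp]: "dim_row (a t) = n" "dim_col (a t) = 1" "dim_row (b t) = q" "dim_col (b t) = 1"
      using a[OF t] b[OF t] by auto
    have "A t = {f. \<forall>j\<in>{..<q}. (\<Sum>k<n. cnj (f (x t, k, j)) * a t $$ (k, 0)) = b t $$ (j, 0)}"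
      unfolding A_def
    proof (intro Collect_cong iffI ballI)
      fix f j assume "mat_adjoint (mat_function n q f (x t)) * a t = b t" and j: "j \<in> {..<q}"
      then have "(mat_adjoint (mat_function n q f (x t)) * a t) $$ (j, 0) = b t $$ (j, 0)" by simp
      then show "(\<Sum>k<n. cnj (f (x t, k, j)) * a t $$ (k, 0)) = b t $$ (j, 0)"
        using j by (simp add: mult_index_sum del: index_mult_mat(1))
    next
      fix f assume *: "\<forall>j\<in>{..<q}. (\<Sum>k<n. cnj (f (x t, k, j)) * a t $$ (k, 0)) = b t $$ (j, 0)"
      show "mat_adjoint (mat_function n q f (x t)) * a t = b t"
        using * by (intro eq_matI) (auto simp: mult_index_sum simp del: index_mult_mat(1))
    qed
    also have "closed \<dots>"
      unfolding Collect_ball_eq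
      by (intro closed_INT ballI closed_Collect_eq continuous_intros continuous_on_product_coordinates)
    finally show ?thesis .
  qed
  have "P \<inter> \<Inter> (insert S (A ` I)) \<noteq> {}"
  proof (rule compact_imp_fip)
    show "compact P" unfolding P_def by (rule compact_unit_polydisc)
    show "closed T" if "T \<in> insert S (A ` I)" for T
      using that cl closed_schur_multipliers by (auto simp: S_def)
  next
    fix F' assume "finite F'" "F' \<subseteq> insert S (A ` I)"
    then have "finite (F' - {S})" "F' - {S} \<subseteq> A ` I" by auto
    then obtain J where J: "J \<subseteq> I" "finite J" "F' - {S} = A ` J"
      by (metis finite_subset_image)
    obtain f where f: "bij_betw f {0..<card J} J"
      using ex_bij_betw_nat_finite[OF J(2)] by blast
    have fI: "f i \<in> I" if "i < card J" for i
      using bij_betwE[OF f] J(1) that by auto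
    obtain \<sigma> where \<sigma>: "schur_multiplier n q (unit_ball N) drury_arveson \<sigma>"
      "\<And>i. i < card J \<Longrightarrow> mat_adjoint (\<sigma> (x (f i))) * a (f i) = b (f i)"
      using tangential_pick_finite[of "card J" "\<lambda>i. x (f i)" N "\<lambda>i. a (f i)" n "\<lambda>i. b (f i)" q]
        x a b pos fI by blast
    define g where "g = (\<lambda>(z, i, j). if z \<in> unit_ball N \<and> i < n \<and> j < q then \<sigma> z $$ (i, j) else 0)"
    have c: "\<sigma> z \<in> carrier_mat n q" if "z \<in> unit_ball N" for z
      using \<sigma>(1) that by (simp add: schur_multiplier_def)
    have g: "mat_function n q g z = \<sigma> z" if "z \<in> unit_ball N" for z
      using c[OF that] that by (intro eq_matI) (auto simp: g_def)
    have "g \<in> P"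
      using schur_multiplier_entry_le_1[OF \<sigma>(1)] by (auto simp: P_def g_def)
    moreover have gS: "g \<in> S"
    proof -
      have "schur_multiplier n q (unit_ball N) drury_arveson (mat_function n q g)
          \<longleftrightarrow> schur_multiplier n q (unit_ball N) drury_arveson \<sigma>"
        unfolding schur_multiplier_def
        by (intro arg_cong2[of _ _ _ _ "(\<and>)"] positive_kernel_cong) (simp_all add: g)
      then show ?thesis using \<sigma>(1) by (simp add: S_def)
    qed
    moreover have gA: "g \<in> A t" if "t \<in> J" for t
    proof -
      have "t \<in> f ` {0..<card J}" by (simp only: bij_betw_imp_surj_on[OF f] that)
      then obtain i where i: "i < card J" "f i = t" by (metis imageE atLeastLessThan_iff)
      then show ?thesis
        using \<sigma>(2)[OF i(1)] x[OF fI[OF i(1)]] by (simp add: A_def g)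
    qed
    moreover have "g \<in> T" if "T \<in> F'" for T
    proof (cases "T = S")
      case False
      then have "T \<in> A ` J" using that J(3) by auto
      then show ?thesis using gA by auto
    qed (use gS in simp)
    ultimately show "P \<inter> \<Inter> F' \<noteq> {}" by auto
  qed
  then obtain f where "f \<in> S" "\<forall>t\<in>I. f \<in> A t" by blast
  then show ?thesis
    unfolding S_def A_def by blast
qed

section \<open>Square roots of rank one perturbations of the identity\<close>

text \<open>A positive semidefinite square root is unique as soon as there is one that is positive
  definite, here written as \<open>T T\<close> with \<open>T\<close> Hermitian and invertible.  If \<open>C\<close> is another root and
  \<open>X = T T - C\<close>, then \<open>X (T T) X + X C X\<close> has trace \<open>0\<close>, and both summands are positive.\<close>

lemma mat_sqrt_eqI:
  fixes T T' A :: "complex mat"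
  assumes T: "T \<in> carrier_mat n n" "mat_adjoint T = T" and T': "T' \<in> carrier_mat n n" "T' * T = 1\<^sub>m n"
    and A: "(T * T) * (T * T) = A"
  shows "mat_sqrt A = T * T"
proof -
  have [simp]: "dim_row T = n" "dim_col T = n" "dim_row T' = n" "dim_col T' = n"
    using T(1) T'(1) by auto
  have An: "dim_row A = n" "dim_col A = n" unfolding A[symmetric] by simp_all
  have psd: "psd_mat n (T * T)"
    unfolding psd_mat_def
  proof (intro conjI ballI)
    show "mat_adjoint (T * T) = T * T" by (simp add: adjoint_mult T(2))
    fix v :: "complex mat" assume "v \<in> carrier_mat n 1"
    then have [simp]: "dim_row v = n" "dim_col v = 1" by auto
    have "mat_adjoint v * (T * T) * v = mat_adjoint (T * v) * (T * v)"
      by (simp add: mat_ring adjoint_mult T(2))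
    then show "0 \<le> entry (mat_adjoint v * (T * T) * v)"
      by (simp add: entry_adjoint_self_nonneg)
  qed (auto intro!: carrier_matI)
  have unique: "C = T * T" if C: "psd_mat n C" "C * C = A" for C
  proof -
    have Cc: "C \<in> carrier_mat n n" and Ca: "mat_adjoint C = C" using C by (auto simp: psd_mat_def)
    have Cd [simp]: "dim_row C = n" "dim_col C = n" using Cc by auto
    have Cpos: "0 \<le> entry (mat_adjoint v * C * v)" if "v \<in> carrier_mat n 1" for v
      using C(1) that unfolding psd_mat_def by blast
    define X where "X = T * T - C"
    have Xd [simp]: "dim_row X = n" "dim_col X = n" by (simp_all add: X_def)
    have Xa: "mat_adjoint X = X"
      by (simp add: X_def adjoint_simps T(2) Ca)
    have eq: "(T * T) * X = - (X * C)"
    proof (rule eq_matI)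
      fix i j assume ij: "i < dim_row (- (X * C))" "j < dim_col (- (X * C))"
      have "(T * T) * X = A - T * (T * C)"
        unfolding A[symmetric] X_def by (simp add: mat_ring)
      moreover have "X * C = T * (T * C) - A"
        unfolding C(2)[symmetric] X_def by (simp add: mat_ring)
      ultimately show "((T * T) * X) $$ (i, j) = (- (X * C)) $$ (i, j)"
        using ij An by (simp del: index_mult_mat(1))
    qed simp_all
    define tr :: "complex mat \<Rightarrow> complex" where "tr M = (\<Sum>i<n. M $$ (i, i))" for M
    have tr_comm: "tr (M * L) = tr (L * M)"
      if "dim_row M = n" "dim_col M = n" "dim_row L = n" "dim_col L = n" for M L
    proof -
      have "tr (M * L) = (\<Sum>i<n. \<Sum>k<n. M $$ (i, k) * L $$ (k, i))"
        unfolding tr_def using that by (simp add: mult_index_sum del: index_mult_mat(1))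
      also have "\<dots> = (\<Sum>k<n. \<Sum>i<n. L $$ (k, i) * M $$ (i, k))"
        by (subst sum.swap) (simp add: mult.commute)
      also have "\<dots> = tr (L * M)"
        unfolding tr_def using that by (simp add: mult_index_sum del: index_mult_mat(1))
      finally show ?thesis .
    qed
    have "tr (X * ((T * T) * X)) = - tr (X * (X * C))"
      unfolding eq tr_def by (simp add: mult_index_sum sum_negf del: index_mult_mat(1))
    also have "tr (X * (X * C)) = tr (X * C * X)"
      by (rule tr_comm) simp_all
    finally have tr0: "tr (X * ((T * T) * X)) + tr (X * C * X) = 0" by simp
    have "X * ((T * T) * X) = mat_adjoint (T * X) * (T * X)"
      by (simp add: adjoint_mult mat_ring Xa T(2))
    then have trT: "tr (X * ((T * T) * X)) = of_real (\<Sum>i<n. \<Sum>k<n. (cmod ((T * X) $$ (k, i)))\<^sup>2)"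
      by (simp add: tr_def mult_index_sum[of _ "mat_adjoint (T * X)"] complex_norm_square mult.commute
          del: index_mult_mat(1) of_real_power)
    have "0 \<le> (X * C * X) $$ (i, i)" if i: "i < n" for i
    proof -
      define u :: "complex mat" where "u = mat n 1 (\<lambda>(k, _). if k = i then 1 else 0)"
      have [simp]: "dim_row u = n" "dim_col u = 1" by (simp_all add: u_def)
      have "0 \<le> entry (mat_adjoint (X * u) * C * (X * u))"
        by (intro Cpos carrier_matI) simp_all
      also have "\<dots> = entry (mat_adjoint u * ((X * C * X) * u))"
        by (simp add: mat_ring adjoint_mult Xa)
      also have "\<dots> = (X * C * X) $$ (i, i)"
        unfolding u_def by (rule entry_unit_vector) (use i in \<open>auto intro!: carrier_matI\<close>)
      finally show ?thesis .
    qed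
    then have "0 \<le> tr (X * C * X)" unfolding tr_def by (intro sum_nonneg) auto
    then have "(\<Sum>i<n. \<Sum>k<n. (cmod ((T * X) $$ (k, i)))\<^sup>2) \<le> 0"
      using tr0 unfolding trT by (simp add: less_eq_complex_def complex_eq_iff del: index_mult_mat(1))
    then have "(\<Sum>i<n. \<Sum>k<n. (cmod ((T * X) $$ (k, i)))\<^sup>2) = 0"
      by (intro antisym sum_nonneg) auto
    then have "\<forall>i<n. \<forall>k<n. (T * X) $$ (k, i) = 0"
      by (simp add: sum_nonneg_eq_0_iff sum_nonneg del: index_mult_mat(1))
    then have "T * X = 0\<^sub>m n n"
      by (intro eq_matI) (auto simp del: index_mult_mat(1))
    then have "T' * (T * X) = 0\<^sub>m n n" by (simp add: mat_mult_zero)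
    moreover have "T' * (T * X) = X"
      by (simp add: mat_mult_assoc[symmetric] T'(2) mat_one_left)
    ultimately have "T * T - C = 0\<^sub>m n n" by (simp add: X_def)
    then show ?thesis by (intro mat_minus_eq_0D[symmetric, of "T * T" C n n]) simp_all
  qed
  show ?thesis
    unfolding mat_sqrt_def An(1)
  proof (rule the_equality)
    show "psd_mat n (T * T) \<and> (T * T) * (T * T) = A" using psd A by (rule conjI)
    show "C = T * T" if "psd_mat n C \<and> C * C = A" for C
      using that by (elim conjE) (rule unique)
  qed
qed

text \<open>The matrix \<open>I + a w w\<^sup>*\<close> for a column \<open>w\<close> of length \<open>n\<close>.  These matrices commute for fixed \<open>w\<close>.\<close>

definition rank_one :: "nat \<Rightarrow> complex \<Rightarrow> complex mat \<Rightarrow> complex mat"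
  where "rank_one n a w = 1\<^sub>m n + a \<cdot>\<^sub>m (w * mat_adjoint w)"

lemma rank_one_dim [simp]:
  assumes "w \<in> carrier_mat n 1"
  shows "dim_row (rank_one n a w) = n" "dim_col (rank_one n a w) = n"
  using assms by (simp_all add: rank_one_def)

lemma rank_one_mult:
  assumes w: "w \<in> carrier_mat n 1"
  shows "rank_one n a w * rank_one n b w = rank_one n (a + b + a * b * entry (mat_adjoint w * w)) w"
proof -
  have [simp]: "dim_row w = n" "dim_col w = 1" using w by auto
  have *: "mat_adjoint w * (w * X) = entry (mat_adjoint w * w) \<cdot>\<^sub>m X" if "dim_row X = 1" for X
    using that by (simp add: mat_mult_assoc[symmetric] mult_entry_left)
  show ?thesis
    unfolding rank_one_def
    by (simp add: mat_ring *) (rule eq_matI, auto simp: algebra_simps simp del: index_mult_mat(1))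
qed

lemma rank_one_zero: "w \<in> carrier_mat n 1 \<Longrightarrow> rank_one n 0 w = 1\<^sub>m n"
  unfolding rank_one_def by (rule eq_matI) auto

lemma rank_one_vector:
  assumes w: "w \<in> carrier_mat n 1"
  shows "rank_one n a w * w = (1 + a * entry (mat_adjoint w * w)) \<cdot>\<^sub>m w"
proof -
  have [simp]: "dim_row w = n" "dim_col w = 1" using w by auto
  show ?thesis
    unfolding rank_one_def
    by (simp add: mat_ring mult_entry_right) (rule eq_matI, auto simp: algebra_simps)
qed

lemma rank_one_adjoint:
  assumes "w \<in> carrier_mat n 1"
  shows "mat_adjoint (rank_one n (of_real a) w) = rank_one n (of_real a) w"
  using assms unfolding rank_one_def by (auto simp: adjoint_simps)

lemma rank_one_root:
  assumes w: "w \<in> carrier_mat n 1" and r: "entry (mat_adjoint w * w) = of_real r" and p: "0 < 1 + t * r"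
  obtains s :: real where "rank_one n (of_real s) w * rank_one n (of_real s) w = rank_one n (of_real t) w"
    and "1 + s * r = sqrt (1 + t * r)" and "s + s + s * s * r = t"
proof -
  define s where "s = (if r = 0 then t / 2 else (sqrt (1 + t * r) - 1) / r)"
  have s: "1 + s * r = sqrt (1 + t * r)" by (simp add: s_def)
  have st: "s + s + s * s * r = t"
  proof (cases "r = 0")
    case False
    have "(1 + s * r) * (1 + s * r) = 1 + t * r" using p by (simp add: s)
    then have "(s + s + s * s * r) * r = t * r" by (simp add: algebra_simps)
    then show ?thesis using False by simp
  qed (simp add: s_def)
  then have "rank_one n (of_real s) w * rank_one n (of_real s) w = rank_one n (of_real t) w"
    unfolding rank_one_mult[OF w] r by (simp flip: of_real_add of_real_mult)
  then show thesis using s st by (rule that)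
qed

lemma rank_one_inverse:
  assumes w: "w \<in> carrier_mat n 1" and r: "entry (mat_adjoint w * w) = of_real r" and p: "0 < 1 + a * r"
  shows "rank_one n (of_real (- a / (1 + a * r))) w * rank_one n (of_real a) w = 1\<^sub>m n"
proof -
  have "- a / (1 + a * r) + a + - a / (1 + a * r) * a * r = 0"
    using p by (simp add: field_simps)
  then have "rank_one n (of_real (- a / (1 + a * r) + a + - a / (1 + a * r) * a * r)) w = 1\<^sub>m n"
    using rank_one_zero[OF w] by simp
  then show ?thesis unfolding rank_one_mult[OF w] r by simp
qed

text \<open>The square root of \<open>I + t w w\<^sup>*\<close> is again of the form \<open>I + s w w\<^sup>*\<close>.  It is positive definite
  because the same construction gives it a square root in turn.\<close>

lemma mat_sqrt_rank_one:
  fixes t r :: real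
  assumes w: "w \<in> carrier_mat n 1" and r: "entry (mat_adjoint w * w) = of_real r" and p: "0 < 1 + t * r"
  defines "E \<equiv> rank_one n (of_real t) w" and "\<kappa> \<equiv> sqrt (1 + t * r)"
  shows "mat_sqrt E \<in> carrier_mat n n" "mat_adjoint (mat_sqrt E) = mat_sqrt E"
    "mat_sqrt E * mat_sqrt E = E" "mat_sqrt E * w = of_real \<kappa> \<cdot>\<^sub>m w"
    "mat_inv (mat_sqrt E) \<in> carrier_mat n n"
    "mat_adjoint (mat_inv (mat_sqrt E)) = mat_inv (mat_sqrt E)"
    "mat_inv (mat_sqrt E) * mat_sqrt E = 1\<^sub>m n" "mat_sqrt E * mat_inv (mat_sqrt E) = 1\<^sub>m n"
    "mat_inv (mat_sqrt E) * w = of_real (1 / \<kappa>) \<cdot>\<^sub>m w"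
    "mat_inv (mat_sqrt E) * mat_inv (mat_sqrt E) = rank_one n (of_real (- t / (1 + t * r))) w"
proof -
  obtain s where s: "rank_one n (of_real s) w * rank_one n (of_real s) w = E"
    and s\<kappa>: "1 + s * r = \<kappa>" and st: "s + s + s * s * r = t"
    using rank_one_root[OF w r p] unfolding E_def \<kappa>_def by blast
  have \<kappa>: "0 < \<kappa>" using p by (simp add: \<kappa>_def)
  then have ps: "0 < 1 + s * r" by (simp add: s\<kappa>)
  obtain u where u: "rank_one n (of_real u) w * rank_one n (of_real u) w = rank_one n (of_real s) w"
    and u\<kappa>: "1 + u * r = sqrt (1 + s * r)"
    using rank_one_root[OF w r ps] by blast
  have pu: "0 < 1 + u * r" using ps by (simp add: u\<kappa>)
  have c: "rank_one n a w \<in> carrier_mat n n" for a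
    using w by (intro carrier_matI) simp_all
  have D: "mat_sqrt E = rank_one n (of_real s) w"
    unfolding u[symmetric]
    by (rule mat_sqrt_eqI[OF c rank_one_adjoint[OF w] c rank_one_inverse[OF w r pu]])
       (simp add: u s)
  define v where "v = - s / (1 + s * r)"
  have I: "mat_inv (mat_sqrt E) = rank_one n (of_real v) w"
    unfolding D v_def by (rule mat_inv_eqI[OF c c rank_one_inverse[OF w r ps]])
  show Dc: "mat_sqrt E \<in> carrier_mat n n" and "mat_adjoint (mat_sqrt E) = mat_sqrt E"
    and "mat_sqrt E * mat_sqrt E = E"
    unfolding D by (rule c, rule rank_one_adjoint[OF w], rule s)
  show Ic: "mat_inv (mat_sqrt E) \<in> carrier_mat n n"
    and "mat_adjoint (mat_inv (mat_sqrt E)) = mat_inv (mat_sqrt E)"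
    unfolding I by (rule c, rule rank_one_adjoint[OF w])
  show ID: "mat_inv (mat_sqrt E) * mat_sqrt E = 1\<^sub>m n"
    unfolding I unfolding D v_def by (rule rank_one_inverse[OF w r ps])
  show "mat_sqrt E * mat_inv (mat_sqrt E) = 1\<^sub>m n"
    by (rule mat_mult_left_right_inverse[OF Ic Dc ID])
  have e: "1 + of_real a * entry (mat_adjoint w * w) = of_real (1 + a * r)" for a
    by (simp add: r)
  show "mat_sqrt E * w = of_real \<kappa> \<cdot>\<^sub>m w"
    unfolding D rank_one_vector[OF w] e s\<kappa> ..
  have "1 + v * r = 1 / \<kappa>"
    using ps unfolding s\<kappa>[symmetric] v_def by (simp add: field_simps)
  then show "mat_inv (mat_sqrt E) * w = of_real (1 / \<kappa>) \<cdot>\<^sub>m w"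
    unfolding I rank_one_vector[OF w] e by simp
  have "v + v + v * v * r = - t / (1 + t * r)"
  proof -
    have "v + v + v * v * r = - (s + s + s * s * r) / ((1 + s * r) * (1 + s * r))"
      using ps by (simp add: v_def divide_simps) (simp add: algebra_simps)
    also have "(1 + s * r) * (1 + s * r) = 1 + t * r"
      unfolding st[symmetric] by (simp add: algebra_simps)
    finally show ?thesis by (simp only: st)
  qed
  then show "mat_inv (mat_sqrt E) * mat_inv (mat_sqrt E) = rank_one n (of_real (- t / (1 + t * r))) w"
    unfolding I rank_one_mult[OF w] r by (simp flip: of_real_add of_real_mult)
qed

section \<open>The Blaschke factor\<close>

lemma blaschke_kernel:
  assumes \<nu>: "\<nu> \<in> unit_ball N" and x: "x \<in> unit_ball N" and y: "y \<in> unit_ball N"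
  shows "blaschke N \<nu> x \<in> carrier_mat 1 N"
    and "row_inner (blaschke N \<nu> x) (blaschke N \<nu> y)
      = 1 - (1 - row_inner \<nu> \<nu>) * (1 - row_inner x y) / ((1 - row_inner x \<nu>) * (1 - row_inner \<nu> y))"
proof -
  note c = \<nu>[THEN unit_ball_carrier] x[THEN unit_ball_carrier] y[THEN unit_ball_carrier]
  have [simp]: "dim_row \<nu> = 1" "dim_col \<nu> = N" "dim_row x = 1" "dim_col x = N"
    "dim_row y = 1" "dim_col y = N"
    using c by auto
  obtain n where n: "row_inner \<nu> \<nu> = of_real n" "n < 1" by (rule row_inner_self_ball[OF \<nu>])
  have w: "mat_adjoint \<nu> \<in> carrier_mat N 1" using c by simp
  have r: "entry (mat_adjoint (mat_adjoint \<nu>) * mat_adjoint \<nu>) = of_real n"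
    using n by (simp add: row_inner_def)
  have E: "1\<^sub>m N - mat_adjoint \<nu> * \<nu> = rank_one N (of_real (- 1)) (mat_adjoint \<nu>)"
    unfolding rank_one_def by (rule eq_matI) (auto simp del: index_mult_mat(1))
  define R where "R = mat_inv (mat_sqrt (1\<^sub>m N - mat_adjoint \<nu> * \<nu>))"
  have p: "0 < 1 + (- 1) * n" using n by simp
  note root = mat_sqrt_rank_one[OF w r p, folded E, folded R_def]
  have [simp]: "dim_row R = N" "dim_col R = N" using root(5) by auto
  have RR: "R * R = 1\<^sub>m N + of_real (1 / (1 - n)) \<cdot>\<^sub>m (mat_adjoint \<nu> * \<nu>)"
    using root(10) unfolding rank_one_def by simp
  let ?s = "complex_of_real (sqrt (1 - n))"
  have b: "blaschke N \<nu> z = (?s / (1 - row_inner z \<nu>)) \<cdot>\<^sub>m ((z - \<nu>) * R)" for z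
    by (simp add: blaschke_def R_def n)
  show "blaschke N \<nu> x \<in> carrier_mat 1 N"
    unfolding b by (rule carrier_matI) simp_all
  have inner: "(x - \<nu>) * (R * (R * mat_adjoint (y - \<nu>)))
      = (x - \<nu>) * mat_adjoint (y - \<nu>) + of_real (1 / (1 - n)) \<cdot>\<^sub>m
        (((x - \<nu>) * mat_adjoint \<nu>) * (\<nu> * mat_adjoint (y - \<nu>)))"
  proof -
    have "(x - \<nu>) * (R * (R * mat_adjoint (y - \<nu>))) = (x - \<nu>) * ((R * R) * mat_adjoint (y - \<nu>))"
      by (simp add: mat_mult_assoc)
    then show ?thesis unfolding RR
      by (simp add: mat_mult_assoc mat_distrib_left mat_distrib_right mat_smult_left mat_smult_right mat_one_left)
  qed
  define \<alpha> \<beta> \<gamma> where "\<alpha> = row_inner x y" and "\<beta> = row_inner x \<nu>" and "\<gamma> = row_inner \<nu> y"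
  have nz: "1 - \<beta> \<noteq> 0" "1 - \<gamma> \<noteq> 0"
    using one_minus_row_inner_nonzero[OF x \<nu>] one_minus_row_inner_nonzero[OF \<nu> y]
    by (simp_all add: \<beta>_def \<gamma>_def)
  have "row_inner (blaschke N \<nu> x) (blaschke N \<nu> y)
      = ?s / (1 - \<beta>) * (cnj (?s / (1 - row_inner y \<nu>))) * entry ((x - \<nu>) * (R * (R * mat_adjoint (y - \<nu>))))"
    unfolding row_inner_def b
    by (simp add: mat_mult_assoc mat_smult_left mat_smult_right adjoint_smult adjoint_mult root(6) entry_smult
        mat_smult_smult \<beta>_def row_inner_def mult.commute)
  also have "cnj (?s / (1 - row_inner y \<nu>)) = ?s / (1 - \<gamma>)"
    using row_inner_commute[OF c(3,1)] by (simp add: \<gamma>_def)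
  also have "entry ((x - \<nu>) * (R * (R * mat_adjoint (y - \<nu>))))
      = (\<alpha> - \<beta> - \<gamma> + of_real n) + (\<beta> - of_real n) * (\<gamma> - of_real n) / (1 - of_real n)"
  proof -
    have e1: "entry ((x - \<nu>) * mat_adjoint (y - \<nu>)) = \<alpha> - \<beta> - \<gamma> + of_real n"
      unfolding \<alpha>_def \<beta>_def \<gamma>_def n(1)[symmetric] row_inner_def
      by (simp add: adjoint_minus mat_minus_left mat_minus_right entry_minus)
    have e2: "entry ((x - \<nu>) * mat_adjoint \<nu>) = \<beta> - of_real n"
      "entry (\<nu> * mat_adjoint (y - \<nu>)) = \<gamma> - of_real n"
      unfolding \<alpha>_def \<beta>_def \<gamma>_def n(1)[symmetric] row_inner_def
      by (simp_all add: adjoint_minus mat_minus_left mat_minus_right entry_minus)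
    show ?thesis
      unfolding inner by (simp add: entry_add entry_smult entry_mult e1 e2)
  qed
  also have "?s / (1 - \<beta>) * (?s / (1 - \<gamma>)) * \<dots>
      = 1 - (1 - of_real n) * (1 - \<alpha>) / ((1 - \<beta>) * (1 - \<gamma>))"
  proof -
    have ss: "?s * ?s = 1 - of_real n"
      using n(2) by (simp flip: of_real_mult)
    have m: "1 - complex_of_real n \<noteq> 0"
      using n(2) by (metis eq_iff_diff_eq_0 less_irrefl of_real_1 of_real_eq_iff)
    have cancel: "k * (X + Y / k) = k * X + Y" if "k \<noteq> 0" for k X Y :: complex
      using that by (simp add: distrib_left)
    have "?s / (1 - \<beta>) * (?s / (1 - \<gamma>)) * ((\<alpha> - \<beta> - \<gamma> + of_real n) + (\<beta> - of_real n) * (\<gamma> - of_real n) / (1 - of_real n))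
      = ((1 - of_real n) * (\<alpha> - \<beta> - \<gamma> + of_real n) + (\<beta> - of_real n) * (\<gamma> - of_real n)) / ((1 - \<beta>) * (1 - \<gamma>))"
    proof -
      have "(1 - of_real n) * ((\<alpha> - \<beta> - \<gamma> + of_real n) + (\<beta> - of_real n) * (\<gamma> - of_real n) / (1 - of_real n))
        = (1 - of_real n) * (\<alpha> - \<beta> - \<gamma> + of_real n) + (\<beta> - of_real n) * (\<gamma> - of_real n)"
        by (rule cancel[OF m])
      then show ?thesis
        unfolding times_divide_times_eq ss by (simp only: times_divide_eq_left)
    qed
    also have "(1 - of_real n) * (\<alpha> - \<beta> - \<gamma> + of_real n) + (\<beta> - of_real n) * (\<gamma> - of_real n)
      = (1 - \<beta>) * (1 - \<gamma>) - (1 - of_real n) * (1 - \<alpha>)"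
      by (simp add: algebra_simps)
    finally show ?thesis using nz by (simp add: diff_divide_distrib)
  qed
  finally show "row_inner (blaschke N \<nu> x) (blaschke N \<nu> y)
      = 1 - (1 - row_inner \<nu> \<nu>) * (1 - row_inner x y) / ((1 - row_inner x \<nu>) * (1 - row_inner \<nu> y))"
    by (simp add: n(1) \<alpha>_def \<beta>_def \<gamma>_def)
qed

section \<open>The linear fractional transformation\<close>

text \<open>The main computation, in the notation of the introduction: the numerator \<open>P P\<^sup>* - Q Q\<^sup>*\<close> is that
  of \<open>G\<close> minus a rank one term.  In the application \<open>x\<close> is the squared norm of \<open>\<xi>\<close> and \<open>W W\<^sup>*\<close>
  is the projection onto the orthogonal complement of \<open>\<xi>\<close>.  The matrix
  \<open>\<mu> \<xi> \<eta>\<^sup>*\<close> with \<open>\<mu> = 1 / (\<delta> \<kappa>)\<close> is the block \<open>B\<close>, because the square root \<open>D\<close> of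
  \<open>I + \<eta> \<eta>\<^sup>* / \<delta>\<close> acts on \<open>\<eta>\<close> as the scalar \<open>\<kappa>\<close>.\<close>

lemma lft_kernel_identity:
  fixes \<xi> \<eta> W D b b' G G' :: "complex mat" and \<delta> \<kappa> x h :: real
  assumes \<xi>: "\<xi> \<in> carrier_mat p 1" and \<eta>: "\<eta> \<in> carrier_mat q 1" and W: "W \<in> carrier_mat p m"
    and b: "b \<in> carrier_mat 1 N" "b' \<in> carrier_mat 1 N"
    and G: "G \<in> carrier_mat p q" "G' \<in> carrier_mat p q" and D: "D \<in> carrier_mat q q"
    and h: "entry (mat_adjoint \<eta> * \<eta>) = of_real h"
    and xh: "x = \<delta> + h" "0 < \<delta>" "0 \<le> h" and \<kappa>: "0 < \<kappa>" "\<kappa> * \<kappa> = x / \<delta>"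
    and DD: "D * D = 1\<^sub>m q + of_real (1 / \<delta>) \<cdot>\<^sub>m (\<eta> * mat_adjoint \<eta>)"
    and Da: "mat_adjoint D = D" and D\<eta>: "D * \<eta> = of_real \<kappa> \<cdot>\<^sub>m \<eta>"
    and WW: "W * mat_adjoint W = 1\<^sub>m p - of_real (1 / x) \<cdot>\<^sub>m (\<xi> * mat_adjoint \<xi>)"
  defines "P \<equiv> \<lambda>b G. ((of_real (1 / sqrt \<delta>) \<cdot>\<^sub>m (\<xi> * b)) @\<^sub>c W) - G * ((of_real (1 / sqrt \<delta>) \<cdot>\<^sub>m (\<eta> * b)) @\<^sub>c 0\<^sub>m q m)"
    and "Q \<equiv> \<lambda>G. of_real (1 / (\<delta> * \<kappa>)) \<cdot>\<^sub>m (\<xi> * mat_adjoint \<eta>) - G * D"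
  shows "P b G * mat_adjoint (P b' G') - Q G * mat_adjoint (Q G')
    = (1\<^sub>m p - G * mat_adjoint G') - ((1 - row_inner b b') / of_real \<delta>) \<cdot>\<^sub>m
      ((\<xi> - G * \<eta>) * mat_adjoint (\<xi> - G' * \<eta>))"
proof -
  have [simp]: "dim_row \<xi> = p" "dim_col \<xi> = 1" "dim_row \<eta> = q" "dim_col \<eta> = 1" "dim_row W = p" "dim_col W = m"
    "dim_row b = 1" "dim_col b = N" "dim_row b' = 1" "dim_col b' = N"
    "dim_row G = p" "dim_col G = q" "dim_row G' = p" "dim_col G' = q" "dim_row D = q" "dim_col D = q"
    using assms(1-8) by auto
  let ?d = "complex_of_real (1 / sqrt \<delta>)"
  have P: "P u H = (?d \<cdot>\<^sub>m ((\<xi> - H * \<eta>) * u)) @\<^sub>c W"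
    if "dim_row u = 1" "dim_row H = p" "dim_col H = q" for u H
  proof -
    have "P u H = (?d \<cdot>\<^sub>m (\<xi> * u) - H * (?d \<cdot>\<^sub>m (\<eta> * u))) @\<^sub>c (W - H * 0\<^sub>m q m)"
      unfolding P_def using that by (simp add: mult_append_cols append_cols_minus[of _ p])
    also have "W - H * 0\<^sub>m q m = W"
      using that by (simp add: mat_mult_zero) (rule eq_matI, auto)
    also have "?d \<cdot>\<^sub>m (\<xi> * u) - H * (?d \<cdot>\<^sub>m (\<eta> * u)) = ?d \<cdot>\<^sub>m ((\<xi> - H * \<eta>) * u)"
      using that by (simp add: mat_ring) (rule eq_matI, auto simp: algebra_simps simp del: index_mult_mat(1))
    finally show ?thesis .
  qed
  have bb: "b * mat_adjoint b' = row_inner b b' \<cdot>\<^sub>m 1\<^sub>m 1"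
    by (rule eq_matI) (auto simp: row_inner_def entry_def simp del: index_mult_mat(1))
  have dd: "?d * ?d = of_real (1 / \<delta>)"
    using xh(2) by (simp flip: of_real_mult)
  define \<rho> \<rho>' where "\<rho> = \<xi> - G * \<eta>" and "\<rho>' = \<xi> - G' * \<eta>"
  have [simp]: "dim_row \<rho> = p" "dim_col \<rho> = 1" "dim_row \<rho>' = p" "dim_col \<rho>' = 1"
    by (simp_all add: \<rho>_def \<rho>'_def)
  have PP: "P b G * mat_adjoint (P b' G')
      = of_real (1 / \<delta>) \<cdot>\<^sub>m (row_inner b b' \<cdot>\<^sub>m (\<rho> * mat_adjoint \<rho>')) + W * mat_adjoint W"
  proof -
    have "P b G * mat_adjoint (P b' G') = ?d \<cdot>\<^sub>m (\<rho> * b) * mat_adjoint (?d \<cdot>\<^sub>m (\<rho>' * b')) + W * mat_adjoint W"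
      by (simp add: P append_cols_mult_adjoint \<rho>_def \<rho>'_def)
    also have "?d \<cdot>\<^sub>m (\<rho> * b) * mat_adjoint (?d \<cdot>\<^sub>m (\<rho>' * b')) = (?d * ?d) \<cdot>\<^sub>m (\<rho> * ((b * mat_adjoint b') * mat_adjoint \<rho>'))"
      by (simp add: adjoint_simps mat_mult_assoc mat_smult_left mat_smult_right mat_smult_smult)
    finally show ?thesis
      unfolding dd bb by (simp add: mat_smult_left mat_smult_right mat_one_left)
  qed
  have \<eta>D: "mat_adjoint \<eta> * D = of_real \<kappa> \<cdot>\<^sub>m mat_adjoint \<eta>"
    using arg_cong[OF D\<eta>, of mat_adjoint] by (simp add: adjoint_simps Da)
  have DDX: "D * (D * X) = X + of_real (1 / \<delta>) \<cdot>\<^sub>m (\<eta> * (mat_adjoint \<eta> * X))" if "dim_row X = q" for X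
  proof -
    have "D * (D * X) = (D * D) * X" using that by (simp add: mat_mult_assoc)
    then show ?thesis unfolding DD using that by (simp add: mat_ring)
  qed
  have \<eta>DX: "mat_adjoint \<eta> * (D * X) = of_real \<kappa> \<cdot>\<^sub>m (mat_adjoint \<eta> * X)" if "dim_row X = q" for X
  proof -
    have "mat_adjoint \<eta> * (D * X) = (mat_adjoint \<eta> * D) * X" using that by (simp add: mat_mult_assoc)
    then show ?thesis unfolding \<eta>D using that by (simp add: mat_ring)
  qed
  have \<eta>\<eta>X: "mat_adjoint \<eta> * (\<eta> * X) = of_real h \<cdot>\<^sub>m X" if "dim_row X = 1" for X
    using that by (simp add: mat_mult_assoc[symmetric] mult_entry_left h)
  have QQ: "Q G * mat_adjoint (Q G') =
     of_real (h / (\<delta> * x)) \<cdot>\<^sub>m (\<xi> * mat_adjoint \<xi>)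
     - of_real (1 / \<delta>) \<cdot>\<^sub>m (\<xi> * (mat_adjoint \<eta> * mat_adjoint G'))
     - of_real (1 / \<delta>) \<cdot>\<^sub>m (G * (\<eta> * mat_adjoint \<xi>))
     + G * mat_adjoint G' + of_real (1 / \<delta>) \<cdot>\<^sub>m (G * (\<eta> * (mat_adjoint \<eta> * mat_adjoint G')))"
  proof -
    define \<mu> where "\<mu> = 1 / (\<delta> * \<kappa>)"
    have s1: "\<mu> * \<mu> * h = h / (\<delta> * x)"
    proof -
      have "\<mu> * \<mu> * h = h / (\<delta> * \<delta> * (\<kappa> * \<kappa>))" by (simp add: \<mu>_def mult_ac)
      then show ?thesis unfolding \<kappa>(2) using xh by simp
    qed
    have s2: "\<mu> * \<kappa> = 1 / \<delta>" using \<kappa>(1) by (simp add: \<mu>_def)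
    have D\<eta>X: "D * (\<eta> * X) = of_real \<kappa> \<cdot>\<^sub>m (\<eta> * X)" if "dim_row X = 1" for X
      using that by (simp add: mat_mult_assoc[symmetric] D\<eta> mat_smult_left)
    show ?thesis
    proof (rule eq_matI)
      fix i j assume "i < dim_row (of_real (h / (\<delta> * x)) \<cdot>\<^sub>m (\<xi> * mat_adjoint \<xi>)
     - of_real (1 / \<delta>) \<cdot>\<^sub>m (\<xi> * (mat_adjoint \<eta> * mat_adjoint G'))
     - of_real (1 / \<delta>) \<cdot>\<^sub>m (G * (\<eta> * mat_adjoint \<xi>))
     + G * mat_adjoint G' + of_real (1 / \<delta>) \<cdot>\<^sub>m (G * (\<eta> * (mat_adjoint \<eta> * mat_adjoint G'))))"
       "j < dim_col (of_real (h / (\<delta> * x)) \<cdot>\<^sub>m (\<xi> * mat_adjoint \<xi>)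
     - of_real (1 / \<delta>) \<cdot>\<^sub>m (\<xi> * (mat_adjoint \<eta> * mat_adjoint G'))
     - of_real (1 / \<delta>) \<cdot>\<^sub>m (G * (\<eta> * mat_adjoint \<xi>))
     + G * mat_adjoint G' + of_real (1 / \<delta>) \<cdot>\<^sub>m (G * (\<eta> * (mat_adjoint \<eta> * mat_adjoint G'))))"
      then have ij: "i < p" "j < p" by simp_all
      have e: "Q G * mat_adjoint (Q G') =
          (of_real (\<mu> * \<mu> * h) \<cdot>\<^sub>m (\<xi> * mat_adjoint \<xi>)
           - of_real (\<mu> * \<kappa>) \<cdot>\<^sub>m (G * (\<eta> * mat_adjoint \<xi>)))
          - (of_real (\<mu> * \<kappa>) \<cdot>\<^sub>m (\<xi> * (mat_adjoint \<eta> * mat_adjoint G'))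
           - (G * mat_adjoint G' + of_real (1 / \<delta>) \<cdot>\<^sub>m (G * (\<eta> * (mat_adjoint \<eta> * mat_adjoint G')))))"
        unfolding Q_def \<mu>_def[symmetric]
        by (simp add: adjoint_simps Da mat_ring \<eta>\<eta>X \<eta>DX DDX D\<eta>X D\<eta>)
           (rule eq_matI, auto simp: algebra_simps simp del: index_mult_mat(1))
      show "(Q G * mat_adjoint (Q G')) $$ (i, j) = (of_real (h / (\<delta> * x)) \<cdot>\<^sub>m (\<xi> * mat_adjoint \<xi>)
     - of_real (1 / \<delta>) \<cdot>\<^sub>m (\<xi> * (mat_adjoint \<eta> * mat_adjoint G'))
     - of_real (1 / \<delta>) \<cdot>\<^sub>m (G * (\<eta> * mat_adjoint \<xi>))
     + G * mat_adjoint G' + of_real (1 / \<delta>) \<cdot>\<^sub>m (G * (\<eta> * (mat_adjoint \<eta> * mat_adjoint G')))) $$ (i, j)"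
        unfolding e s1 s2 using ij by (simp del: index_mult_mat(1))
    qed (simp_all add: Q_def)
  qed
  have s3: "1 / complex_of_real x + of_real h / (of_real \<delta> * of_real x) = 1 / of_real \<delta>"
  proof -
    have "1 / x + h / (\<delta> * x) = \<delta> / (\<delta> * x) + h / (\<delta> * x)" using xh(2) by simp
    also have "\<dots> = x / (\<delta> * x)" unfolding xh(1) by (rule add_divide_distrib[symmetric])
    also have "\<dots> = 1 / \<delta>" using xh by simp
    finally have "1 / x + h / (\<delta> * x) = 1 / \<delta>" .
    from arg_cong[OF this, of complex_of_real] show ?thesis by simp
  qed
  have s3': "of_real h / (of_real \<delta> * of_real x) = 1 / of_real \<delta> - 1 / complex_of_real x"
    using s3 by (simp add: algebra_simps)
  have \<rho>\<rho>: "\<rho> * mat_adjoint \<rho>' = (\<xi> * mat_adjoint \<xi> - G * (\<eta> * mat_adjoint \<xi>))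
      - (\<xi> * (mat_adjoint \<eta> * mat_adjoint G') - G * (\<eta> * (mat_adjoint \<eta> * mat_adjoint G')))"
    unfolding \<rho>_def \<rho>'_def by (simp add: adjoint_simps mat_ring)
  show ?thesis
    unfolding \<rho>_def[symmetric] \<rho>'_def[symmetric] PP QQ WW \<rho>\<rho>
    by (rule eq_matI)
       (auto simp: s3' algebra_simps diff_divide_distrib add_divide_distrib simp del: index_mult_mat(1))
qed

text \<open>The theorem on the whole ball, for a single point \<open>\<nu>\<close> and with any \<open>W\<close> for which \<open>W W\<^sup>*\<close>
  is the projection onto the orthogonal complement of \<open>\<xi>\<close>.\<close>

lemma schur_multiplier_reduction:
  fixes \<xi> \<eta> \<nu> W :: "complex mat" and G :: "complex mat \<Rightarrow> complex mat" and \<delta> x h :: real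
  assumes G: "schur_multiplier p q (unit_ball N) drury_arveson G"
    and \<nu>: "\<nu> \<in> unit_ball N" and \<xi>: "\<xi> \<in> carrier_mat p 1" and \<eta>: "\<eta> = mat_adjoint (G \<nu>) * \<xi>"
    and x: "entry (mat_adjoint \<xi> * \<xi>) = of_real x" and h: "entry (mat_adjoint \<eta> * \<eta>) = of_real h"
    and xh: "x = \<delta> + h" "0 < \<delta>"
    and W: "W \<in> carrier_mat p m" "mat_adjoint \<xi> * W = 0\<^sub>m 1 m"
      "W * mat_adjoint W = 1\<^sub>m p - of_real (1 / x) \<cdot>\<^sub>m (\<xi> * mat_adjoint \<xi>)"
  defines "E \<equiv> 1\<^sub>m q + of_real (1 / \<delta>) \<cdot>\<^sub>m (\<eta> * mat_adjoint \<eta>)"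
  defines "A \<equiv> \<lambda>\<zeta>. (of_real (1 / sqrt \<delta>) \<cdot>\<^sub>m (\<xi> * blaschke N \<nu> \<zeta>)) @\<^sub>c W"
    and "B \<equiv> of_real (1 / \<delta>) \<cdot>\<^sub>m (\<xi> * mat_adjoint \<eta>) * mat_inv (mat_sqrt E)"
    and "C \<equiv> \<lambda>\<zeta>. (of_real (1 / sqrt \<delta>) \<cdot>\<^sub>m (\<eta> * blaschke N \<nu> \<zeta>)) @\<^sub>c 0\<^sub>m q m"
    and "D \<equiv> mat_sqrt E"
  shows "\<exists>s. schur_multiplier (m + N) q (unit_ball N) drury_arveson s \<and>
    (\<forall>\<zeta>\<in>unit_ball N. invertible_mat (C \<zeta> * s \<zeta> + D) \<and>
      G \<zeta> = (A \<zeta> * s \<zeta> + B) * mat_inv (C \<zeta> * s \<zeta> + D))"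
proof -
  have Gc: "G \<zeta> \<in> carrier_mat p q" if "\<zeta> \<in> unit_ball N" for \<zeta>
    using G that by (simp add: schur_multiplier_def)
  have Gd [simp]: "dim_row (G \<zeta>) = p" "dim_col (G \<zeta>) = q" if "\<zeta> \<in> unit_ball N" for \<zeta>
    using Gc[OF that] by auto
  have \<xi>d [simp]: "dim_row \<xi> = p" "dim_col \<xi> = 1" using \<xi> by auto
  have \<eta>d [simp]: "dim_row \<eta> = q" "dim_col \<eta> = 1" using \<nu> by (simp_all add: \<eta>)
  have Wd [simp]: "dim_row W = p" "dim_col W = m" using W(1) by auto
  have \<eta>c: "\<eta> \<in> carrier_mat q 1" by (rule carrier_matI) simp_all
  have h0: "0 \<le> h" using entry_adjoint_self_nonneg[of \<eta>] h by (simp add: less_eq_complex_def)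
  have x0: "0 < x" using xh h0 by simp
  note blc = blaschke_kernel(1)[OF \<nu> _ \<nu>]
  have bld [simp]: "dim_row (blaschke N \<nu> \<zeta>) = 1" "dim_col (blaschke N \<nu> \<zeta>) = N" if "\<zeta> \<in> unit_ball N" for \<zeta>
    using blc[OF that] by auto

  \<comment> \<open>the square root of \<open>E\<close> acts on \<open>\<eta>\<close> as the scalar \<open>\<kappa>\<close>\<close>
  define \<kappa> where "\<kappa> = sqrt (1 + 1 / \<delta> * h)"
  have k1: "1 + 1 / \<delta> * h = x / \<delta>" using xh by (simp add: field_simps)
  have p: "0 < 1 + 1 / \<delta> * h" unfolding k1 using x0 xh by simp
  have \<kappa>: "0 < \<kappa>" "\<kappa> * \<kappa> = x / \<delta>"
    using x0 xh(2) unfolding \<kappa>_def k1 by simp_all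
  have E: "E = rank_one q (of_real (1 / \<delta>)) \<eta>" by (simp add: E_def rank_one_def)
  note root = mat_sqrt_rank_one[OF \<eta>c h p, folded E \<kappa>_def, folded D_def]
  have Dd [simp]: "dim_row D = q" "dim_col D = q" using root(1) by auto
  have Id [simp]: "dim_row (mat_inv D) = q" "dim_col (mat_inv D) = q" using root(5) by auto
  have \<eta>I: "mat_adjoint \<eta> * mat_inv D = of_real (1 / \<kappa>) \<cdot>\<^sub>m mat_adjoint \<eta>"
    using arg_cong[OF root(9), of mat_adjoint] by (simp add: adjoint_simps root(6))
  define \<mu> where "\<mu> = 1 / (\<delta> * \<kappa>)"
  have B: "B = of_real \<mu> \<cdot>\<^sub>m (\<xi> * mat_adjoint \<eta>)"
    unfolding B_def D_def[symmetric] by (simp add: mat_mult_assoc mat_smult_left mat_smult_right mat_smult_smult \<eta>I \<mu>_def)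
  have Bd [simp]: "dim_row B = p" "dim_col B = q" by (simp_all add: B)
  have Ad [simp]: "dim_row (A \<zeta>) = p" "dim_col (A \<zeta>) = N + m"
    and Cd [simp]: "dim_row (C \<zeta>) = q" "dim_col (C \<zeta>) = N + m" if "\<zeta> \<in> unit_ball N" for \<zeta>
    using that by (simp_all add: A_def C_def)

  \<comment> \<open>the columns of the block matrix are orthogonal in the indefinite inner product\<close>
  have DC: "D * C \<zeta> = mat_adjoint B * A \<zeta>" if l: "\<zeta> \<in> unit_ball N" for \<zeta>
  proof -
    let ?d = "complex_of_real (1 / sqrt \<delta>)"
    have "D * C \<zeta> = (D * (?d \<cdot>\<^sub>m (\<eta> * blaschke N \<nu> \<zeta>))) @\<^sub>c (D * 0\<^sub>m q m)"
      unfolding C_def using l by (simp add: mult_append_cols)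
    also have "D * (?d \<cdot>\<^sub>m (\<eta> * blaschke N \<nu> \<zeta>)) = (?d * of_real \<kappa>) \<cdot>\<^sub>m (\<eta> * blaschke N \<nu> \<zeta>)"
      using l by (simp add: mat_smult_right mat_mult_assoc[symmetric] root(4) mat_smult_left mat_smult_smult)
    also have "D * 0\<^sub>m q m = 0\<^sub>m q m" by (simp add: mat_mult_zero)
    finally have 1: "D * C \<zeta> = ((?d * of_real \<kappa>) \<cdot>\<^sub>m (\<eta> * blaschke N \<nu> \<zeta>)) @\<^sub>c 0\<^sub>m q m" .
    have Ba: "mat_adjoint B = of_real \<mu> \<cdot>\<^sub>m (\<eta> * mat_adjoint \<xi>)"
      by (simp add: B adjoint_simps)
    have "mat_adjoint B * A \<zeta> = (mat_adjoint B * (?d \<cdot>\<^sub>m (\<xi> * blaschke N \<nu> \<zeta>))) @\<^sub>c (mat_adjoint B * W)"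
      unfolding A_def using l by (simp add: mult_append_cols)
    also have "mat_adjoint B * (?d \<cdot>\<^sub>m (\<xi> * blaschke N \<nu> \<zeta>))
        = (?d * of_real (\<mu> * x)) \<cdot>\<^sub>m (\<eta> * blaschke N \<nu> \<zeta>)"
    proof -
      have "mat_adjoint \<xi> * (\<xi> * X) = of_real x \<cdot>\<^sub>m X" if "dim_row X = 1" for X
        using that by (simp add: mat_mult_assoc[symmetric] mult_entry_left x)
      then show ?thesis
        unfolding Ba using l by (simp add: mat_smult_left mat_smult_right mat_mult_assoc mat_smult_smult mult_ac)
    qed
    also have "mat_adjoint B * W = 0\<^sub>m q m"
      unfolding Ba by (simp add: mat_smult_left mat_mult_assoc W(2) mat_mult_zero)
    also have "\<mu> * x = \<kappa>"
    proof -
      have "\<kappa> * \<kappa> * \<delta> = x" unfolding \<kappa>(2) using xh(2) by simp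
      then show ?thesis unfolding \<mu>_def using \<kappa>(1) xh(2) by (simp add: field_simps)
    qed
    finally show ?thesis using 1 by simp
  qed
  have DB: "D * D - mat_adjoint B * B = 1\<^sub>m q"
  proof -
    have \<xi>\<xi>X: "mat_adjoint \<xi> * (\<xi> * X) = of_real x \<cdot>\<^sub>m X" if "dim_row X = 1" for X
      using that by (simp add: mat_mult_assoc[symmetric] mult_entry_left x)
    have "mat_adjoint B * B = of_real (\<mu> * \<mu> * x) \<cdot>\<^sub>m (\<eta> * mat_adjoint \<eta>)"
      unfolding B by (simp add: adjoint_simps mat_smult_left mat_smult_right mat_mult_assoc mat_smult_smult \<xi>\<xi>X mult_ac)
    also have "\<mu> * \<mu> * x = 1 / \<delta>"
    proof -
      have "\<mu> * \<mu> * x = x / (\<delta> * \<delta> * (\<kappa> * \<kappa>))" by (simp add: \<mu>_def mult_ac)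
      then show ?thesis unfolding \<kappa>(2) using xh x0 by simp
    qed
    finally have BB: "mat_adjoint B * B = of_real (1 / \<delta>) \<cdot>\<^sub>m (\<eta> * mat_adjoint \<eta>)" .
    show ?thesis
      unfolding BB root(3) E_def by (rule eq_matI) (auto simp del: index_mult_mat(1))
  qed

  \<comment> \<open>the data of the equation \<open>P s = - Q\<close>, which is tested on all column vectors \<open>u\<close>\<close>
  define P where "P \<zeta> = A \<zeta> - G \<zeta> * C \<zeta>" for \<zeta>
  define Q where "Q \<zeta> = B - G \<zeta> * D" for \<zeta>
  have PQd [simp]: "dim_row (P \<zeta>) = p" "dim_col (P \<zeta>) = N + m" "dim_row (Q \<zeta>) = p" "dim_col (Q \<zeta>) = q"
    if "\<zeta> \<in> unit_ball N" for \<zeta>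
    using that by (simp_all add: P_def Q_def)
  define \<rho> where "\<rho> \<zeta> = \<xi> - G \<zeta> * \<eta>" for \<zeta>
  have \<rho>d [simp]: "dim_row (\<rho> \<zeta>) = p" "dim_col (\<rho> \<zeta>) = 1" if "\<zeta> \<in> unit_ball N" for \<zeta>
    using that by (simp_all add: \<rho>_def)
  define g where "g \<zeta> \<tau> = (1 - row_inner (blaschke N \<nu> \<zeta>) (blaschke N \<nu> \<tau>)) / of_real \<delta>" for \<zeta> \<tau>
  have PQ: "P \<zeta> * mat_adjoint (P \<tau>) - Q \<zeta> * mat_adjoint (Q \<tau>)
      = (1\<^sub>m p - G \<zeta> * mat_adjoint (G \<tau>)) - g \<zeta> \<tau> \<cdot>\<^sub>m (\<rho> \<zeta> * mat_adjoint (\<rho> \<tau>))"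
    if l: "\<zeta> \<in> unit_ball N" and t: "\<tau> \<in> unit_ball N" for \<zeta> \<tau>
    unfolding P_def Q_def A_def C_def B \<mu>_def \<rho>_def g_def
    by (rule lft_kernel_identity[OF \<xi> \<eta>c W(1) blc[OF l] blc[OF t] Gc[OF l] Gc[OF t] root(1) h xh h0 \<kappa>
          root(3)[unfolded E_def] root(2) root(4) W(3)])
  let ?K = "\<lambda>z w. drury_arveson z w \<cdot>\<^sub>m (1\<^sub>m p - G z * mat_adjoint (G w))"
  have pk: "positive_kernel p (unit_ball N) ?K"
    using G by (simp add: schur_multiplier_def)
  obtain n where n: "row_inner \<nu> \<nu> = of_real n" "n < 1" by (rule row_inner_self_ball[OF \<nu>])
  have g: "drury_arveson \<zeta> \<tau> * g \<zeta> \<tau>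
      = drury_arveson \<zeta> \<nu> * drury_arveson \<nu> \<tau> / (drury_arveson \<nu> \<nu> * of_real \<delta>)"
    if l: "\<zeta> \<in> unit_ball N" and t: "\<tau> \<in> unit_ball N" for \<zeta> \<tau>
    unfolding g_def blaschke_kernel(2)[OF \<nu> l t] drury_arveson_def
    using one_minus_row_inner_nonzero[OF l t] by simp
  define I where "I = {(\<zeta>, u). \<zeta> \<in> unit_ball N \<and> u \<in> (carrier_mat p 1 :: complex mat set)}"
  define a where "a = (\<lambda>(\<zeta>, u). mat_adjoint (P \<zeta>) * u)"
  define b where "b = (\<lambda>(\<zeta>, u). (- 1) \<cdot>\<^sub>m (mat_adjoint (Q \<zeta>) * u))"
  have "\<exists>s. schur_multiplier (m + N) q (unit_ball N) drury_arveson s \<and>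
      (\<forall>t\<in>I. mat_adjoint (s (fst t)) * a t = b t)"
  proof (rule tangential_pick)
    fix k and f :: "nat \<Rightarrow> complex mat \<times> complex mat"
    assume f: "\<And>i. i < k \<Longrightarrow> f i \<in> I"
    \<comment> \<open>append the point \<open>\<nu>\<close> with the vector \<open>\<xi>\<close>, and take the Schur complement there\<close>
    define y where "y i = (if i < k then fst (f i) else \<nu>)" for i
    define u where "u i = (if i < k then snd (f i) else \<xi>)" for i
    have y: "y i \<in> unit_ball N" for i
      using f[of i] \<nu> by (auto simp: y_def I_def)
    have u: "u i \<in> carrier_mat p 1" for i
      using f[of i] \<xi> by (auto simp: u_def I_def)
    have ud [simp]: "dim_row (u i) = p" "dim_col (u i) = 1" for i using u[of i] by auto
    note yd [simp] = Gd[OF y] PQd[OF y] \<rho>d[OF y]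
    define L where "L i j = entry (mat_adjoint (u i) * (?K (y i) (y j) * u j))" for i j
    have "psd_form (Suc k) L"
      unfolding L_def by (rule positive_kernel_psd_form[OF pk y u])
    then have "psd_form k (\<lambda>i j. L i j - L i k * L k j / L k k)"
      by (rule psd_form_schur_complement)
    also have "?this \<longleftrightarrow> psd_form k (\<lambda>i j. drury_arveson (fst (f i)) (fst (f j)) *
        entry (mat_adjoint (a (f i)) * a (f j) - mat_adjoint (b (f i)) * b (f j)))"
    proof (rule psd_form_cong)
      fix i j assume ij: "i < k" "j < k"
      have yk: "y k = \<nu>" "u k = \<xi>" by (simp_all add: y_def u_def)
      have Gv [simp]: "dim_row (G \<nu>) = p" "dim_col (G \<nu>) = q" using Gd[OF \<nu>] by auto
      have fi: "f i = (y i, u i)" "f j = (y j, u j)" using ij by (simp_all add: y_def u_def)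
      have Lik: "L i k = drury_arveson (y i) \<nu> * entry (mat_adjoint (u i) * \<rho> (y i))"
        unfolding L_def yk \<rho>_def \<eta>
        by (simp add: mat_smult_left mat_smult_right entry_smult mat_minus_right mat_one_left mat_mult_assoc)
      have Lkj: "L k j = drury_arveson \<nu> (y j) * entry (mat_adjoint (\<rho> (y j)) * u j)"
        unfolding L_def yk \<rho>_def \<eta>
        by (simp add: mat_smult_left mat_smult_right entry_smult mat_minus_right mat_minus_left
            mat_one_left mat_mult_assoc adjoint_simps)
      have Lkk: "L k k = drury_arveson \<nu> \<nu> * of_real \<delta>"
      proof -
        have "L k k = drury_arveson \<nu> \<nu> * (entry (mat_adjoint \<xi> * \<xi>) - entry (mat_adjoint \<eta> * \<eta>))"
          unfolding L_def yk \<eta>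
          by (simp add: mat_smult_left mat_smult_right entry_smult entry_minus mat_minus_right mat_minus_left
              mat_one_left mat_mult_assoc adjoint_simps)
        then show ?thesis by (simp add: x h xh(1))
      qed
      have er: "entry (mat_adjoint (u i) * (\<rho> (y i) * (mat_adjoint (\<rho> (y j)) * u j)))
          = entry (mat_adjoint (u i) * \<rho> (y i)) * entry (mat_adjoint (\<rho> (y j)) * u j)"
      proof -
        have "mat_adjoint (u i) * (\<rho> (y i) * (mat_adjoint (\<rho> (y j)) * u j))
            = (mat_adjoint (u i) * \<rho> (y i)) * (mat_adjoint (\<rho> (y j)) * u j)"
          by (simp add: mat_mult_assoc)
        then show ?thesis by (simp add: entry_mult)
      qed
      have "entry (mat_adjoint (a (f i)) * a (f j) - mat_adjoint (b (f i)) * b (f j))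
          = entry (mat_adjoint (u i) * ((P (y i) * mat_adjoint (P (y j)) - Q (y i) * mat_adjoint (Q (y j))) * u j))"
        unfolding fi a_def b_def
        by (simp add: adjoint_simps mat_smult_left mat_smult_right mat_smult_smult mat_mult_assoc
            mat_minus_left mat_minus_right) (simp add: entry_def)
      also have "\<dots> = entry (mat_adjoint (u i) * ((1\<^sub>m p - G (y i) * mat_adjoint (G (y j))) * u j))
          - g (y i) (y j) * (entry (mat_adjoint (u i) * \<rho> (y i)) * entry (mat_adjoint (\<rho> (y j)) * u j))"
        unfolding PQ[OF y y]
        by (simp add: mat_smult_left mat_smult_right mat_minus_left mat_minus_right mat_mult_assoc
            entry_minus entry_smult mat_one_left er)
      finally have e: "entry (mat_adjoint (a (f i)) * a (f j) - mat_adjoint (b (f i)) * b (f j)) = \<dots>" .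
      have Lij: "L i j = drury_arveson (y i) (y j) *
          entry (mat_adjoint (u i) * ((1\<^sub>m p - G (y i) * mat_adjoint (G (y j))) * u j))"
        unfolding L_def by (simp add: mat_smult_left mat_smult_right entry_smult)
      have "L i k * L k j / L k k = (drury_arveson (y i) \<nu> * drury_arveson \<nu> (y j) / (drury_arveson \<nu> \<nu> * of_real \<delta>))
          * (entry (mat_adjoint (u i) * \<rho> (y i)) * entry (mat_adjoint (\<rho> (y j)) * u j))"
        unfolding Lik Lkj Lkk by simp
      also have "\<dots> = drury_arveson (y i) (y j) * (g (y i) (y j)
          * (entry (mat_adjoint (u i) * \<rho> (y i)) * entry (mat_adjoint (\<rho> (y j)) * u j)))"
        unfolding g[OF y y, symmetric] by (simp only: mult.assoc)
      finally show "L i j - L i k * L k j / L k k = drury_arveson (fst (f i)) (fst (f j)) *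
        entry (mat_adjoint (a (f i)) * a (f j) - mat_adjoint (b (f i)) * b (f j))"
        unfolding e Lij by (simp only: fi fst_conv right_diff_distrib)
    qed
    finally show "psd_form k (\<lambda>i j. drury_arveson (fst (f i)) (fst (f j)) *
        entry (mat_adjoint (a (f i)) * a (f j) - mat_adjoint (b (f i)) * b (f j)))" .
  qed (auto simp: I_def a_def b_def intro!: carrier_matI)
  then obtain s where s: "schur_multiplier (m + N) q (unit_ball N) drury_arveson s"
    and sI: "\<And>t. t \<in> I \<Longrightarrow> mat_adjoint (s (fst t)) * a t = b t"
    by (elim exE conjE) blast

  have "invertible_mat (C \<zeta> * s \<zeta> + D) \<and> G \<zeta> = (A \<zeta> * s \<zeta> + B) * mat_inv (C \<zeta> * s \<zeta> + D)"
    if l: "\<zeta> \<in> unit_ball N" for \<zeta>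
  proof -
    have sc: "s \<zeta> \<in> carrier_mat (m + N) q" using s l by (simp add: schur_multiplier_def)
    have sd [simp]: "dim_row (s \<zeta>) = N + m" "dim_col (s \<zeta>) = q" using sc by auto
    note ld [simp] = Gd[OF l] PQd[OF l] Ad[OF l] Cd[OF l]
    have "mat_adjoint (s \<zeta>) * mat_adjoint (P \<zeta>) = (- 1) \<cdot>\<^sub>m mat_adjoint (Q \<zeta>)"
    proof (rule mat_eq_columnsI)
      fix v :: "complex mat" assume v: "v \<in> carrier_mat p 1"
      then have [simp]: "dim_row v = p" "dim_col v = 1" by auto
      have "mat_adjoint (s \<zeta>) * (mat_adjoint (P \<zeta>) * v) = (- 1) \<cdot>\<^sub>m (mat_adjoint (Q \<zeta>) * v)"
        using sI[of "(\<zeta>, v)"] l v by (simp add: I_def a_def b_def)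
      then show "mat_adjoint (s \<zeta>) * mat_adjoint (P \<zeta>) * v = (- 1) \<cdot>\<^sub>m mat_adjoint (Q \<zeta>) * v"
        by (simp add: mat_mult_assoc mat_smult_left)
    qed (auto intro!: carrier_matI)
    from arg_cong[OF this, of mat_adjoint]
    have Ps: "P \<zeta> * s \<zeta> = (- 1) \<cdot>\<^sub>m Q \<zeta>" by (simp add: adjoint_simps)
    define M where "M = C \<zeta> * s \<zeta> + D"
    have Md [simp]: "dim_row M = q" "dim_col M = q" by (simp_all add: M_def)
    have GM: "G \<zeta> * M = A \<zeta> * s \<zeta> + B"
    proof (rule eq_matI)
      fix i j assume ij: "i < dim_row (A \<zeta> * s \<zeta> + B)" "j < dim_col (A \<zeta> * s \<zeta> + B)"
      have "(A \<zeta> * s \<zeta> - G \<zeta> * (C \<zeta> * s \<zeta>)) $$ (i, j) = ((- 1) \<cdot>\<^sub>m (B - G \<zeta> * D)) $$ (i, j)"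
        using Ps by (simp add: P_def Q_def mat_minus_right mat_mult_assoc)
      then show "(G \<zeta> * M) $$ (i, j) = (A \<zeta> * s \<zeta> + B) $$ (i, j)"
        unfolding M_def using ij by (simp add: mat_distrib_left algebra_simps del: index_mult_mat(1))
    qed simp_all
    \<comment> \<open>orthogonality makes \<open>D - B\<^sup>* G\<close> a left inverse of \<open>C s + D\<close>\<close>
    define M' where "M' = D - mat_adjoint B * G \<zeta>"
    have M'd [simp]: "dim_row M' = q" "dim_col M' = q" by (simp_all add: M'_def)
    have M'M: "M' * M = 1\<^sub>m q"
    proof -
      have "M' * M = D * M - mat_adjoint B * (G \<zeta> * M)"
        unfolding M'_def by (simp add: mat_minus_right mat_mult_assoc)
      also have "\<dots> = (D * C \<zeta> * s \<zeta> + D * D) - (mat_adjoint B * A \<zeta> * s \<zeta> + mat_adjoint B * B)"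
        unfolding GM unfolding M_def by (simp add: mat_distrib_left mat_mult_assoc)
      also have "\<dots> = D * D - mat_adjoint B * B"
        unfolding DC[OF l] by (rule eq_matI) (auto simp del: index_mult_mat(1))
      finally show ?thesis by (simp only: DB)
    qed
    have Mc: "M \<in> carrier_mat q q" "M' \<in> carrier_mat q q" by (auto intro!: carrier_matI)
    have MM': "M * M' = 1\<^sub>m q" by (rule mat_mult_left_right_inverse[OF Mc(2,1) M'M])
    have inv: "mat_inv M = M'" by (rule mat_inv_eqI[OF Mc M'M])
    have "invertible_mat M"
      unfolding invertible_mat_def inverts_mat_def square_mat.simps
      using MM' M'M by (intro conjI exI[of _ M']) simp_all
    moreover have "G \<zeta> = (A \<zeta> * s \<zeta> + B) * mat_inv M"
      unfolding inv GM[symmetric] by (simp add: mat_mult_assoc MM' mat_one_right)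
    ultimately show ?thesis unfolding M_def by simp
  qed
  then show ?thesis using s by blast
qed

theorem theorem4:
  fixes N p q :: nat
    and \<Omega> :: "(complex ^ 'd) set"
    and \<beta> S :: "complex ^ 'd \<Rightarrow> complex mat"
    and G :: "complex mat \<Rightarrow> complex mat"
    and w0 :: "complex ^ 'd"
    and \<xi> \<eta> c U U1 U2 U3 U4 :: "complex mat"
    and \<delta> :: real
  assumes "0 < N" and "0 < p" and "0 < q"
    and "open \<Omega>" and "\<Omega> \<subseteq> ball 0 1"
    and "\<forall>z \<in> \<Omega>. \<beta> z \<in> unit_ball N"
    and "\<forall>j<N. continuous_on \<Omega> (\<lambda>z. \<beta> z $$ (0, j))"
    and "schur_multiplier p q \<Omega> (\<lambda>z w. 1 / (1 - row_inner (\<beta> z) (\<beta> w))) S"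
    and "schur_multiplier p q (unit_ball N) drury_arveson G"
    and "\<forall>z \<in> \<Omega>. S z = G (\<beta> z)"
    and "w0 \<in> \<Omega>"
    and "\<xi> \<in> carrier_mat p 1"
    and "entry (mat_adjoint \<xi> * S w0 * mat_adjoint (S w0) * \<xi>) < entry (mat_adjoint \<xi> * \<xi>)"
    and "\<eta> = mat_adjoint (S w0) * \<xi>"
    and "c = \<xi> @\<^sub>r \<eta>"
    and "\<delta> = Re (entry (mat_adjoint c * J_mat p q * c))"
    and "unitary_mat p U"
    and "U = four_block_mat U1 U2 U3 U4"
    and "U1 \<in> carrier_mat (p - 1) (p - 1)" and "U2 \<in> carrier_mat (p - 1) 1"
    and "U3 \<in> carrier_mat 1 (p - 1)" and "U4 \<in> carrier_mat 1 1"
    and "U2 @\<^sub>r U4 = complex_of_real (1 / sqrt (Re (entry (mat_adjoint \<xi> * \<xi>)))) \<cdot>\<^sub>m \<xi>"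
  shows "\<exists>s. schur_multiplier (p - 1 + N) q (unit_ball N) drury_arveson s \<and>
    (\<forall>z \<in> \<Omega>.
      let b = blaschke N (\<beta> w0) (\<beta> z);
          E = 1\<^sub>m q + complex_of_real (1 / \<delta>) \<cdot>\<^sub>m (\<eta> * mat_adjoint \<eta>);
          A = (complex_of_real (1 / sqrt \<delta>) \<cdot>\<^sub>m (\<xi> * b)) @\<^sub>c (U1 @\<^sub>r U3);
          B = complex_of_real (1 / \<delta>) \<cdot>\<^sub>m (\<xi> * mat_adjoint \<eta>) * mat_inv (mat_sqrt E);
          C = (complex_of_real (1 / sqrt \<delta>) \<cdot>\<^sub>m (\<eta> * b)) @\<^sub>c 0\<^sub>m q (p - 1);
          D = mat_sqrt E
      in invertible_mat (C * s (\<beta> z) + D) \<and>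
         S z = (A * s (\<beta> z) + B) * mat_inv (C * s (\<beta> z) + D))"
proof -
  define \<nu> where "\<nu> = \<beta> w0"
  have \<nu>: "\<nu> \<in> unit_ball N" using assms(6,11) by (simp add: \<nu>_def)
  have Sw: "S w0 = G \<nu>" using assms(10,11) by (simp add: \<nu>_def)
  have Gd [simp]: "dim_row (G \<nu>) = p" "dim_col (G \<nu>) = q"
    using assms(9) \<nu> by (auto simp: schur_multiplier_def)
  have \<xi>d [simp]: "dim_row \<xi> = p" "dim_col \<xi> = 1" using assms(12) by auto
  have \<eta>: "\<eta> = mat_adjoint (G \<nu>) * \<xi>" using assms(14) Sw by simp
  have \<eta>d [simp]: "dim_row \<eta> = q" "dim_col \<eta> = 1" by (simp_all add: \<eta>)
  have real: "entry (mat_adjoint v * v) = of_real (Re (entry (mat_adjoint v * v)))" if "dim_col v = 1" for v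
    using entry_adjoint_self_nonneg[OF that] by (auto simp: less_eq_complex_def complex_eq_iff)
  define x where "x = Re (entry (mat_adjoint \<xi> * \<xi>))"
  define h where "h = Re (entry (mat_adjoint \<eta> * \<eta>))"
  have x: "entry (mat_adjoint \<xi> * \<xi>) = of_real x" and h: "entry (mat_adjoint \<eta> * \<eta>) = of_real h"
    unfolding x_def h_def by (rule real, simp)+
  have "mat_adjoint \<xi> * S w0 * mat_adjoint (S w0) * \<xi> = mat_adjoint \<eta> * \<eta>"
    unfolding Sw \<eta> by (simp add: mat_mult_assoc adjoint_simps)
  then have hx: "h < x"
    using assms(13) x h by (simp add: less_complex_def)
  have h0: "0 \<le> h" using entry_adjoint_self_nonneg[of \<eta>] h by (simp add: less_eq_complex_def)
  have \<delta>: "\<delta> = x - h"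
  proof -
    have "J_mat p q * c = \<xi> @\<^sub>r ((- 1) \<cdot>\<^sub>m \<eta>)"
    proof -
      have "J_mat p q * c = (1\<^sub>m p * \<xi> + 0\<^sub>m p q * \<eta>) @\<^sub>r (0\<^sub>m q p * \<xi> + (- 1\<^sub>m q) * \<eta>)"
        unfolding J_mat_def assms(15)
        by (rule four_block_mult_append_rows[of _ p p _ q _ q _ _ 1]) (auto intro!: carrier_matI)
      also have "1\<^sub>m p * \<xi> + 0\<^sub>m p q * \<eta> = \<xi>"
        by (simp add: mat_one_left mat_zero_mult) (rule eq_matI, auto)
      also have "- 1\<^sub>m q = (- 1) \<cdot>\<^sub>m (1\<^sub>m q :: complex mat)" by (rule eq_matI) auto
      also have "0\<^sub>m q p * \<xi> + ((- 1) \<cdot>\<^sub>m 1\<^sub>m q) * \<eta> = (- 1) \<cdot>\<^sub>m \<eta>"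
        by (simp add: mat_one_left mat_zero_mult mat_smult_left) (rule eq_matI, auto)
      finally show ?thesis .
    qed
    moreover have "mat_adjoint c * J_mat p q * c = mat_adjoint c * (J_mat p q * c)"
      by (rule mat_mult_assoc) (simp_all add: assms(15) J_mat_def)
    ultimately have "mat_adjoint c * J_mat p q * c = mat_adjoint \<xi> * \<xi> + mat_adjoint \<eta> * ((- 1) \<cdot>\<^sub>m \<eta>)"
      unfolding assms(15) by (simp add: adjoint_append_rows_mult)
    then have "entry (mat_adjoint c * J_mat p q * c) = of_real x - of_real h"
      by (simp add: mat_smult_right entry_add entry_smult x h)
    then show ?thesis unfolding assms(16) by simp
  qed
  have xh: "x = \<delta> + h" "0 < \<delta>" using \<delta> hx by simp_all
  have x0: "0 < x" using xh h0 by simp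
  define W where "W = U1 @\<^sub>r U3"
  define v where "v = complex_of_real (1 / sqrt x) \<cdot>\<^sub>m \<xi>"
  have Ud: "dim_row U1 = p - 1" "dim_col U1 = p - 1" "dim_row U2 = p - 1" "dim_col U2 = 1"
    "dim_row U3 = 1" "dim_col U3 = p - 1" "dim_row U4 = 1" "dim_col U4 = 1"
    using assms(19-22) by auto
  have Wd [simp]: "dim_row W = p" "dim_col W = p - 1" using Ud assms(2) by (simp_all add: W_def)
  have vd [simp]: "dim_row v = p" "dim_col v = 1" by (simp_all add: v_def)
  have U: "U = W @\<^sub>c v"
  proof (rule eq_matI)
    fix i j assume "i < dim_row (W @\<^sub>c v)" "j < dim_col (W @\<^sub>c v)"
    then have ij: "i < p" "j < p - 1 + 1" by simp_all
    have "v = U2 @\<^sub>r U4" using assms(23) by (simp add: v_def x_def)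
    then show "U $$ (i, j) = (W @\<^sub>c v) $$ (i, j)"
      unfolding assms(18) W_def using ij Ud
      by (auto simp: append_cols_index append_rows_index)
  qed (use Ud assms(2) in \<open>auto simp: assms(18)\<close>)
  have vv: "v * mat_adjoint v = of_real (1 / x) \<cdot>\<^sub>m (\<xi> * mat_adjoint \<xi>)"
  proof -
    have "complex_of_real (1 / sqrt x) * of_real (1 / sqrt x) = of_real (1 / x)"
      using x0 by (simp flip: of_real_mult)
    then show ?thesis
      by (simp add: v_def adjoint_simps mat_smult_left mat_smult_right mat_smult_smult)
  qed
  have WW: "W * mat_adjoint W = 1\<^sub>m p - of_real (1 / x) \<cdot>\<^sub>m (\<xi> * mat_adjoint \<xi>)"
  proof -
    have "W * mat_adjoint W + v * mat_adjoint v = 1\<^sub>m p"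
      using assms(17) unfolding unitary_mat_def U by (simp add: append_cols_mult_adjoint)
    note sum = this
    show ?thesis
      unfolding vv[symmetric]
    proof (rule eq_matI)
      fix i j assume "i < dim_row (1\<^sub>m p - v * mat_adjoint v)" "j < dim_col (1\<^sub>m p - v * mat_adjoint v)"
      then have ij: "i < p" "j < p" by simp_all
      have "(W * mat_adjoint W + v * mat_adjoint v) $$ (i, j) = 1\<^sub>m p $$ (i, j)"
        by (simp only: sum)
      then show "(W * mat_adjoint W) $$ (i, j) = (1\<^sub>m p - v * mat_adjoint v) $$ (i, j)"
        using ij by (simp add: algebra_simps del: index_mult_mat(1) index_one_mat(1))
    qed simp_all
  qed
  \<comment> \<open>\<open>W W\<^sup>* \<xi> = 0\<close>, hence \<open>W\<^sup>* \<xi>\<close> has norm \<open>0\<close>\<close>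
  have \<xi>W: "mat_adjoint \<xi> * W = 0\<^sub>m 1 (p - 1)"
  proof -
    have "W * (mat_adjoint W * \<xi>) = \<xi> - of_real (1 / x) \<cdot>\<^sub>m (\<xi> * (mat_adjoint \<xi> * \<xi>))"
      by (simp add: mat_mult_assoc[symmetric] WW) (simp add: mat_minus_right mat_one_left mat_smult_left mat_mult_assoc)
    also have "\<dots> = 0\<^sub>m p 1"
      using x0 by (simp add: mult_entry_right x mat_smult_smult) (rule eq_matI, auto)
    finally have "mat_adjoint (mat_adjoint W * \<xi>) * (mat_adjoint W * \<xi>) = mat_adjoint \<xi> * 0\<^sub>m p 1"
      by (simp add: adjoint_simps mat_mult_assoc)
    then have "entry (mat_adjoint (mat_adjoint W * \<xi>) * (mat_adjoint W * \<xi>)) = 0"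
      by (simp add: mat_mult_zero entry_def)
    then have "mat_adjoint W * \<xi> = 0\<^sub>m (p - 1) 1"
      using entry_adjoint_self_eq_0[of "mat_adjoint W * \<xi>"] by simp
    from arg_cong[OF this, of mat_adjoint] show ?thesis by (simp add: adjoint_simps)
  qed
  have Wc: "W \<in> carrier_mat p (p - 1)" by (rule carrier_matI) simp_all
  from schur_multiplier_reduction[OF assms(9) \<nu> assms(12) \<eta> x h xh Wc \<xi>W WW]
  obtain s where s: "schur_multiplier (p - 1 + N) q (unit_ball N) drury_arveson s"
    and sG: "\<And>\<zeta>. \<zeta> \<in> unit_ball N \<Longrightarrow>
      invertible_mat (((of_real (1 / sqrt \<delta>) \<cdot>\<^sub>m (\<eta> * blaschke N \<nu> \<zeta>)) @\<^sub>c 0\<^sub>m q (p - 1)) * s \<zeta>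
        + mat_sqrt (1\<^sub>m q + of_real (1 / \<delta>) \<cdot>\<^sub>m (\<eta> * mat_adjoint \<eta>))) \<and>
      G \<zeta> = (((of_real (1 / sqrt \<delta>) \<cdot>\<^sub>m (\<xi> * blaschke N \<nu> \<zeta>)) @\<^sub>c W) * s \<zeta>
        + of_real (1 / \<delta>) \<cdot>\<^sub>m (\<xi> * mat_adjoint \<eta>)
          * mat_inv (mat_sqrt (1\<^sub>m q + of_real (1 / \<delta>) \<cdot>\<^sub>m (\<eta> * mat_adjoint \<eta>)))) *
        mat_inv (((of_real (1 / sqrt \<delta>) \<cdot>\<^sub>m (\<eta> * blaschke N \<nu> \<zeta>)) @\<^sub>c 0\<^sub>m q (p - 1)) * s \<zeta>
        + mat_sqrt (1\<^sub>m q + of_real (1 / \<delta>) \<cdot>\<^sub>m (\<eta> * mat_adjoint \<eta>)))"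
    by blast
  show ?thesis
    unfolding Let_def
  proof (intro exI[of _ s] conjI ballI s)
    fix z assume z: "z \<in> \<Omega>"
    then have bz: "\<beta> z \<in> unit_ball N" and Sz: "S z = G (\<beta> z)" using assms(6,10) by auto
    note * = sG[OF bz, unfolded W_def \<nu>_def, folded Sz]
    show "invertible_mat (((complex_of_real (1 / sqrt \<delta>) \<cdot>\<^sub>m (\<eta> * blaschke N (\<beta> w0) (\<beta> z))) @\<^sub>c 0\<^sub>m q (p - 1)) * s (\<beta> z)
        + mat_sqrt (1\<^sub>m q + complex_of_real (1 / \<delta>) \<cdot>\<^sub>m (\<eta> * mat_adjoint \<eta>)))"
      by (rule *[THEN conjunct1])
    show "S z = (((complex_of_real (1 / sqrt \<delta>) \<cdot>\<^sub>m (\<xi> * blaschke N (\<beta> w0) (\<beta> z))) @\<^sub>c (U1 @\<^sub>r U3)) * s (\<beta> z)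
        + complex_of_real (1 / \<delta>) \<cdot>\<^sub>m (\<xi> * mat_adjoint \<eta>)
          * mat_inv (mat_sqrt (1\<^sub>m q + complex_of_real (1 / \<delta>) \<cdot>\<^sub>m (\<eta> * mat_adjoint \<eta>)))) *
        mat_inv (((complex_of_real (1 / sqrt \<delta>) \<cdot>\<^sub>m (\<eta> * blaschke N (\<beta> w0) (\<beta> z))) @\<^sub>c 0\<^sub>m q (p - 1)) * s (\<beta> z)
        + mat_sqrt (1\<^sub>m q + complex_of_real (1 / \<delta>) \<cdot>\<^sub>m (\<eta> * mat_adjoint \<eta>)))"
      by (rule *[THEN conjunct2])
  qed
qed

end
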